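(* For every nowhere dense class of graphs $\mathcal{C}$ and every $d\in\mathbb{N}$, there exists $q\in\mathbb{N}$ such that for every $n$-vertex graph $H\in\overline{\mathcal{C}^d}$, the number of inclusion-wise maximal cliques in $H$ is at most $n^q$. Moreover, given $H\in\overline{\mathcal{C}^d}$, all maximal cliques in $H$ can be enumerated in polynomial time.
   Context: All graphs are finite, simple and undirected. $G^d$ is the graph on $V(G)$ where distinct $u,v$ are adjacent iff their distance in $G$ is at most $d$; $\mathcal{C}^d=\{G^d:G\in\mathcal{C}\}$; $\overline{\mathcal{D}}$ denotes the class of all induced subgraphs of graphs in $\mathcal{D}$. A graph is a depth-$r$ minor of $G$ if it is obtained from a subgraph of $G$ by contracting pairwise disjoint connected subgraphs of radius at most $r$; a class $\mathcal{C}$ is nowhere dense if for every $r\in\mathbb{N}$ there is a bound on the clique number of depth-$r$ minors of graphs in $\mathcal{C}$. *)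

theory Defs
  imports "Graph_Theory.Graph_Theory" "HOL-Computational_Algebra.Polynomial"
begin

section \<open>Powers, induced subgraphs and cliques\<close>

text \<open>
  Finite simple undirected graphs are the \<open>pair_graph\<close>s of the library: an undirected edge
  \<open>{u, v}\<close> is the pair of arcs \<open>(u, v)\<close>, \<open>(v, u)\<close>.
\<close>

definition gdist :: "'a pair_pre_digraph \<Rightarrow> 'a \<Rightarrow> 'a \<Rightarrow> ereal" where
  "gdist G u v = wf_digraph.\<mu> (with_proj G) (\<lambda>_. 1) u v"

definition graph_power :: "nat \<Rightarrow> 'a pair_pre_digraph \<Rightarrow> 'a pair_pre_digraph" where
  "graph_power d G =
     \<lparr> pverts = pverts G,
       parcs = {(u, v). u \<in> pverts G \<and> v \<in> pverts G \<and> u \<noteq> v \<and> gdist G u v \<le> ereal (real d)} \<rparr>"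

definition induced_closure :: "'a pair_pre_digraph set \<Rightarrow> 'a pair_pre_digraph set" where
  "induced_closure \<D> = {H. \<exists>G\<in>\<D>. induced_subgraph (with_proj H) (with_proj G)}"

text \<open>
  Cliques are non-empty. This only matters for the graph without vertices, which thereby has no
  maximal clique at all; otherwise it would have one, exceeding \<open>0 ^ q\<close> for every \<open>q > 0\<close>.
\<close>

definition clique :: "'a pair_pre_digraph \<Rightarrow> 'a set \<Rightarrow> bool" where
  "clique G K \<longleftrightarrow> K \<noteq> {} \<and> K \<subseteq> pverts G \<and> (\<forall>u\<in>K. \<forall>v\<in>K. u \<noteq> v \<longrightarrow> (u, v) \<in> parcs G)"

definition maximal_cliques :: "'a pair_pre_digraph \<Rightarrow> 'a set set" where
  "maximal_cliques G = {K. clique G K \<and> (\<forall>K'. clique G K' \<and> K \<subseteq> K' \<longrightarrow> K' = K)}"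

text \<open>On type \<open>nat\<close>, \<open>Sup\<close> is the maximum of a non-empty finite set, and \<open>Sup {} = 0\<close>.\<close>

definition clique_number :: "'a pair_pre_digraph \<Rightarrow> nat" where
  "clique_number G = Sup (card ` {K. clique G K})"

section \<open>Shallow minors and nowhere dense classes\<close>

definition radius :: "'a pair_pre_digraph \<Rightarrow> ereal" where
  "radius G = (INF c\<in>pverts G. SUP v\<in>pverts G. gdist G c v)"

text \<open>
  Contracting the members of \<open>\<B>\<close>, which are pairwise disjoint subgraphs of \<open>G\<close>. A vertex of the
  result is the set of those vertices of \<open>G\<close> that are identified to form it.
\<close>

definition contract :: "'a pair_pre_digraph \<Rightarrow> 'a pair_pre_digraph set \<Rightarrow> 'a set pair_pre_digraph"
  where
  "contract G \<B> =
     (let V = pverts ` \<B> \<union> {{v} |v. v \<in> pverts G \<and> v \<notin> (\<Union>B\<in>\<B>. pverts B)}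
      in \<lparr> pverts = V,
           parcs = {(X, Y). X \<in> V \<and> Y \<in> V \<and> X \<noteq> Y \<and> (\<exists>x\<in>X. \<exists>y\<in>Y. (x, y) \<in> parcs G)} \<rparr>)"

definition depth_minors :: "nat \<Rightarrow> 'a pair_pre_digraph \<Rightarrow> 'a set pair_pre_digraph set" where
  "depth_minors r G =
     {contract S \<B> |S \<B>.
        pair_graph S \<and> subgraph (with_proj S) (with_proj G) \<and>
        (\<forall>B\<in>\<B>. pair_graph B \<and> subgraph (with_proj B) (with_proj S) \<and>
           Digraph_Component.connected (with_proj B) \<and> radius B \<le> ereal (real r)) \<and>
        (\<forall>B\<in>\<B>. \<forall>B'\<in>\<B>. B \<noteq> B' \<longrightarrow> pverts B \<inter> pverts B' = {})}"

definition nowhere_dense :: "'a pair_pre_digraph set \<Rightarrow> bool" where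
  "nowhere_dense \<C> \<longleftrightarrow>
     (\<forall>r. \<exists>k. \<forall>G\<in>\<C>. \<forall>M\<in>depth_minors r G. clique_number M \<le> k)"

section \<open>Polynomial time\<close>

text \<open>
  The machine model is a structured random access machine with the unit cost measure. A program
  uses finitely many memories, addressed by natural numbers, whose cells hold natural numbers;
  scalar variables are cells with a constant address. Addition and truncated subtraction are the
  only arithmetic operations, so within \<open>t\<close> steps the bit length of the numbers grows by at most
  \<open>O(t)\<close>, and polynomial time on this machine is polynomial time on Turing machines. Every
  assignment and every test costs one step: the expressions occurring in a program do not
  depend on the input, so that their size only contributes a constant factor.
\<close>

datatype exp = Const nat | Read nat exp | Add exp exp | Sub exp exp

datatype prog =
  Skip | Write nat exp exp | Seq prog prog | If exp prog prog | While exp prog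

type_synonym store = "nat \<Rightarrow> nat \<Rightarrow> nat"

primrec val :: "exp \<Rightarrow> store \<Rightarrow> nat" where
  "val (Const k) s = k"
| "val (Read m e) s = s m (val e s)"
| "val (Add e f) s = val e s + val f s"
| "val (Sub e f) s = val e s - val f s"

text \<open>\<open>Write m e f\<close> stores the value of \<open>f\<close> in cell \<open>e\<close> of memory \<open>m\<close>; a test succeeds if its
  value is non-zero. \<open>exec c s t s'\<close>: started in \<open>s\<close>, the program \<open>c\<close> halts after \<open>t\<close> steps
  in \<open>s'\<close>.\<close>

inductive exec :: "prog \<Rightarrow> store \<Rightarrow> nat \<Rightarrow> store \<Rightarrow> bool" where
  Skip: "exec Skip s 1 s"
| Write: "exec (Write m e f) s 1 (s(m := (s m)(val e s := val f s)))"
| Seq: "exec c s t s' \<Longrightarrow> exec c' s' t' s'' \<Longrightarrow> exec (Seq c c') s (t + t') s''"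
| IfTrue: "val e s \<noteq> 0 \<Longrightarrow> exec c s t s' \<Longrightarrow> exec (If e c c') s (1 + t) s'"
| IfFalse: "val e s = 0 \<Longrightarrow> exec c' s t s' \<Longrightarrow> exec (If e c c') s (1 + t) s'"
| WhileFalse: "val e s = 0 \<Longrightarrow> exec (While e c) s 1 s"
| WhileTrue: "val e s \<noteq> 0 \<Longrightarrow> exec c s t s' \<Longrightarrow> exec (While e c) s' t' s'' \<Longrightarrow>
    exec (While e c) s (1 + t + t') s''"

definition input_store :: "nat list \<Rightarrow> store" where
  "input_store xs = (\<lambda>m i. if m = 0 \<and> i < length xs then xs ! i else 0)"

definition is_output :: "store \<Rightarrow> nat list \<Rightarrow> bool" where
  "is_output s ys \<longleftrightarrow> (\<forall>i<length ys. s 1 i = ys ! i)"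

text \<open>
  One program solves all instances in \<open>I\<close>, in time polynomial in the length of the encoded
  instance. The encoding should only contain numbers that are polynomial in that length, and the
  encoding of solutions should be self-delimiting, as the output memory is infinite.
\<close>

definition poly_time_solvable ::
  "'i set \<Rightarrow> ('i \<Rightarrow> nat list) \<Rightarrow> ('i \<Rightarrow> nat list \<Rightarrow> bool) \<Rightarrow> bool" where
  "poly_time_solvable I encode solution \<longleftrightarrow>
     (\<exists>c (p :: nat poly). \<forall>x\<in>I. \<exists>t s ys.
        exec c (input_store (encode x)) t s \<and> t \<le> poly p (length (encode x)) \<and>
        is_output s ys \<and> solution x ys)"

text \<open>
  A graph is presented to the machine by the number of its vertices and its adjacency matrix, with
  respect to an arbitrary enumeration \<open>vs\<close> of the vertices; vertices are then
  referred to by their position in \<open>vs\<close>.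
\<close>

definition presentations :: "'a pair_pre_digraph set \<Rightarrow> ('a pair_pre_digraph \<times> 'a list) set" where
  "presentations \<D> = {(H, vs). H \<in> \<D> \<and> distinct vs \<and> set vs = pverts H}"

definition encode_graph :: "'a pair_pre_digraph \<times> 'a list \<Rightarrow> nat list" where
  "encode_graph = (\<lambda>(H, vs).
     length vs # concat (map (\<lambda>u. map (\<lambda>v. if (u, v) \<in> parcs H then 1 else 0) vs) vs))"

definition encode_lists :: "nat list list \<Rightarrow> nat list" where
  "encode_lists Ks = length Ks # concat (map (\<lambda>K. length K # K) Ks)"

text \<open>Every maximal clique is listed exactly once, as a list of its vertices without repetition.\<close>

definition enumerates_maximal_cliques :: "'a pair_pre_digraph \<times> 'a list \<Rightarrow> nat list \<Rightarrow> bool" where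
  "enumerates_maximal_cliques = (\<lambda>(H, vs) ys.
     \<exists>Ks. ys = encode_lists Ks \<and>
       (\<forall>K\<in>set Ks. distinct K \<and> (\<forall>i\<in>set K. i < length vs)) \<and>
       distinct (map (\<lambda>K. (!) vs ` set K) Ks) \<and>
       set (map (\<lambda>K. (!) vs ` set K) Ks) = maximal_cliques H)"

end

theory Submission
  imports Defs "HOL-Library.Ramsey"
begin

text \<open>
  A co-matching consists of vertices \<open>a\<^sub>1, \<dots>, a\<^sub>k\<close> and \<open>b\<^sub>1, \<dots>, b\<^sub>k\<close> with \<open>a\<^sub>i\<close> adjacent to \<open>b\<^sub>j\<close>
  iff \<open>i \<noteq> j\<close>. Graphs on \<open>n\<close> vertices without large co-matchings have few maximal cliques: a maximal
  clique that appears when a vertex \<open>v\<close> is added but does not arise from an old one is \<open>v\<close> together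
  with a maximal clique of the common neighbourhood of \<open>v\<close> and some non-neighbour \<open>w\<close> of \<open>v\<close>, and
  passing to that neighbourhood shortens the co-matchings.

  Powers of a nowhere dense class have no large co-matchings. By uniform quasi-wideness, the removal of
  boundedly many vertices \<open>S\<close> makes many \<open>a\<^sub>i\<close> pairwise far apart. Among three of them with
  the same distances to \<open>S\<close>, at most one reaches \<open>b\<^sub>i\<close> without meeting \<open>S\<close>, so a short path from another
  one to \<open>b\<^sub>i\<close> goes through \<open>S\<close> and can be rerouted to start in \<open>a\<^sub>i\<close>.

  Since every prefix of the vertex list also induces few maximal cliques, they can be enumerated by
  adding the vertices one by one: from each maximal clique \<open>K\<close> of the old graph one obtains the
  candidates \<open>K\<close> and \<open>{v} \<union> (K \<inter> N(v))\<close>.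
\<close>

section \<open>Few maximal cliques without large co-matchings\<close>

text \<open>Quasi-wideness helps only with its quantifiers in the right order: the bound
  \<open>s\<close> on the deleted set is fixed before the size \<open>m\<close> of the scattered
  set, so that \<open>m\<close> can exceed twice the number of distance profiles to the deleted set.
  To achieve this, the radius grows by one at a time, and each step may delete only as many vertices
  as the excluded clique minor has branch sets. The class may be infinite, so every Ramsey bound is
  chosen before the relation \<open>E\<close>. Working with relations and balls \<open>reach\<close>
  keeps this argument free of vertex sets and walks; graphs return only when branch sets become
  minors and \<open>reach\<close> becomes distance. For the algorithm, time bounds are terms over an
  arbitrary commutative semiring: the same term is a number in the correctness proof and a
  polynomial in the final statement.\<close>

definition max_cliques_on :: "('a \<Rightarrow> 'a \<Rightarrow> bool) \<Rightarrow> 'a set \<Rightarrow> 'a set set" where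
  "max_cliques_on E V = {K. K \<subseteq> V \<and> (\<forall>x\<in>K. \<forall>y\<in>K. x \<noteq> y \<longrightarrow> E x y) \<and> (\<forall>v\<in>V - K. \<exists>x\<in>K. \<not> E v x)}"

lemma finite_max_cliques_on: "finite V \<Longrightarrow> finite (max_cliques_on E V)"
  by (rule finite_subset[of _ "Pow V"]) (auto simp: max_cliques_on_def)

text \<open>Admitting the empty clique here gives both the count and the program a start: all
  maximal cliques grow from this single one as vertices are added.\<close>

lemma max_cliques_on_empty [simp]: "max_cliques_on E {} = {{}}"
  by (auto simp: max_cliques_on_def)

lemma clique_extends:
  assumes "finite V" "symp E" "K \<subseteq> V" "\<forall>x\<in>K. \<forall>y\<in>K. x \<noteq> y \<longrightarrow> E x y"
  shows "\<exists>C\<in>max_cliques_on E V. K \<subseteq> C"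
proof -
  let ?F = "{C. K \<subseteq> C \<and> C \<subseteq> V \<and> (\<forall>x\<in>C. \<forall>y\<in>C. x \<noteq> y \<longrightarrow> E x y)}"
  have "finite ?F"
    using assms(1) by (auto intro: finite_subset[of _ "Pow V"])
  moreover have "?F \<noteq> {}"
    using assms by blast
  ultimately have "\<exists>C\<in>?F. \<forall>D\<in>?F. C \<subseteq> D \<longrightarrow> C = D"
    by (rule finite_has_maximal)
  then obtain C where C: "C \<in> ?F" "\<forall>D\<in>?F. C \<subseteq> D \<longrightarrow> C = D" ..
  have "\<exists>x\<in>C. \<not> E v x" if v: "v \<in> V - C" for v
  proof (rule ccontr)
    assume "\<not> ?thesis"
    then have "insert v C \<in> ?F"
      using v C(1) assms(2) by (auto dest: sympD)
    then show False
      using bspec[OF C(2), of "insert v C"] v by blast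
  qed
  then show ?thesis
    using C(1) by (auto simp: max_cliques_on_def)
qed

text \<open>A maximal clique \<open>C\<close> through \<open>v\<close> leaves a clique
  \<open>C - {v}\<close> of \<open>V\<close>. Any maximal clique \<open>K\<close> of
  \<open>V\<close> above it gives back \<open>C\<close> as \<open>v\<close> together with the
  neighbours of \<open>v\<close> in \<open>K\<close>, by maximality of \<open>C\<close>. The filter
  discards candidates that are not maximal; this equation is the correctness of one round of the
  program.\<close>

lemma max_cliques_on_insert:
  assumes "finite V" "symp E" "v \<notin> V"
  shows "max_cliques_on E (insert v V) =
    {C \<in> max_cliques_on E V \<union> (\<lambda>K. insert v {x \<in> K. E v x}) ` max_cliques_on E V.
      \<forall>x\<in>insert v V - C. \<exists>y\<in>C. \<not> E x y}" (is "_ = ?R")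
proof
  show "?R \<subseteq> max_cliques_on E (insert v V)"
    using assms(2) by (auto simp: max_cliques_on_def dest: sympD)
  show "max_cliques_on E (insert v V) \<subseteq> ?R"
  proof
    fix C assume C: "C \<in> max_cliques_on E (insert v V)"
    show "C \<in> ?R"
    proof (cases "v \<in> C")
      case False
      then show ?thesis using C by (auto simp: max_cliques_on_def)
    next
      case True
      have "C - {v} \<subseteq> V" "\<forall>x\<in>C - {v}. \<forall>y\<in>C - {v}. x \<noteq> y \<longrightarrow> E x y"
        using C by (auto simp: max_cliques_on_def)
      from clique_extends[OF assms(1,2) this] obtain K where
        K: "K \<in> max_cliques_on E V" "C - {v} \<subseteq> K"
        by blast
      have "C \<subseteq> insert v {x \<in> K. E v x}"
        using C K True by (auto simp: max_cliques_on_def)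
      moreover have "x \<in> C" if x: "x \<in> K" "E v x" for x
      proof (rule ccontr)
        assume "x \<notin> C"
        then obtain y where y: "y \<in> C" "\<not> E x y"
          using C K x(1) unfolding max_cliques_on_def by blast
        have "y \<noteq> v" using y x assms(2) by (auto dest: sympD)
        then have "y \<in> K" using y K by auto
        then show False using y x K \<open>x \<notin> C\<close> by (auto simp: max_cliques_on_def)
      qed
      ultimately have "C = insert v {x \<in> K. E v x}"
        using True by auto
      then show ?thesis
        using K(1) C by (auto simp: max_cliques_on_def)
    qed
  qed
qed

text \<open>Stronger than a co-matching: vertices of different pairs are adjacent in all four
  combinations. The recursion follows the descent to common neighbourhoods in the counting
  argument.\<close>

fun comatching_on :: "('a \<Rightarrow> 'a \<Rightarrow> bool) \<Rightarrow> nat \<Rightarrow> 'a set \<Rightarrow> bool" where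
  "comatching_on E 0 V = True"
| "comatching_on E (Suc k) V =
    (\<exists>v\<in>V. \<exists>w\<in>V. v \<noteq> w \<and> \<not> E v w \<and> comatching_on E k {x \<in> V. E v x \<and> E w x})"

lemma comatching_on_mono: "comatching_on E k U \<Longrightarrow> U \<subseteq> V \<Longrightarrow> comatching_on E k V"
proof (induction k arbitrary: U V)
  case (Suc k)
  then obtain v w where vw: "v \<in> U" "w \<in> U" "v \<noteq> w" "\<not> E v w"
      "comatching_on E k {x \<in> U. E v x \<and> E w x}"
    by auto
  have "{x \<in> U. E v x \<and> E w x} \<subseteq> {x \<in> V. E v x \<and> E w x}"
    using Suc.prems(2) by auto
  then have "comatching_on E k {x \<in> V. E v x \<and> E w x}"
    using Suc.IH vw(5) by blast
  then show ?case
    using vw Suc.prems(2) by auto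
qed simp

lemma comatching_on_SucD: "comatching_on E (Suc k) V \<Longrightarrow> comatching_on E k V"
proof -
  assume "comatching_on E (Suc k) V"
  then obtain v w where "comatching_on E k {x \<in> V. E v x \<and> E w x}"
    by auto
  then show ?thesis
    by (rule comatching_on_mono) auto
qed

lemma comatching_onD:
  assumes "symp E" "comatching_on E k V"
  shows "\<exists>a b. \<forall>i<k. a i \<in> V \<and> b i \<in> V \<and> a i \<noteq> b i \<and> \<not> E (a i) (b i) \<and>
    (\<forall>j<k. i \<noteq> j \<longrightarrow> E (a i) (b j))"
  using assms(2)
proof (induction k arbitrary: V)
  case (Suc k)
  then obtain v w where vw: "v \<in> V" "w \<in> V" "v \<noteq> w" "\<not> E v w"
      "comatching_on E k {x \<in> V. E v x \<and> E w x}"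
    by auto
  from Suc.IH[OF vw(5)] obtain a b where ab: "\<forall>i<k. (a i \<in> V \<and> E v (a i) \<and> E w (a i)) \<and>
     (b i \<in> V \<and> E v (b i) \<and> E w (b i)) \<and> a i \<noteq> b i \<and> \<not> E (a i) (b i) \<and>
    (\<forall>j<k. i \<noteq> j \<longrightarrow> E (a i) (b j))"
    by auto
  have "\<forall>i<Suc k. (a(k := v)) i \<in> V \<and> (b(k := w)) i \<in> V \<and> (a(k := v)) i \<noteq> (b(k := w)) i \<and>
      \<not> E ((a(k := v)) i) ((b(k := w)) i) \<and>
      (\<forall>j<Suc k. i \<noteq> j \<longrightarrow> E ((a(k := v)) i) ((b(k := w)) j))"
    using ab vw assms(1) by (auto simp: less_Suc_eq dest: sympD)
  then show ?case by blast
qed simp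

text \<open>The three parts collect the cliques without \<open>v\<close>, those that stay maximal in
  \<open>V\<close> when \<open>v\<close> is removed, and the rest. In the last case some
  \<open>w\<close> extends \<open>K - {v}\<close> in \<open>V\<close>, and \<open>w\<close> is not
  adjacent to \<open>v\<close>, since otherwise it would extend \<open>K\<close>.\<close>

lemma max_cliques_on_insert_subset:
  assumes "symp E" "v \<notin> V"
  shows "max_cliques_on E (insert v V) \<subseteq>
    {K \<in> max_cliques_on E V. \<exists>x\<in>K. \<not> E v x} \<union> insert v ` {K \<in> max_cliques_on E V. \<forall>x\<in>K. E v x}
    \<union> (\<Union>w\<in>{w \<in> V. \<not> E v w}. insert v ` max_cliques_on E {x \<in> V. E v x \<and> E w x})" (is "_ \<subseteq> ?R")
proof
  fix K assume K: "K \<in> max_cliques_on E (insert v V)"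
  show "K \<in> ?R"
  proof (cases "v \<in> K")
    case False
    then show ?thesis using K by (auto simp: max_cliques_on_def)
  next
    case True
    have K': "K = insert v (K - {v})" "\<forall>x\<in>K - {v}. E v x" "K - {v} \<subseteq> V"
      using K True assms by (auto simp: max_cliques_on_def)
    show ?thesis
    proof (cases "K - {v} \<in> max_cliques_on E V")
      case True
      then show ?thesis using K' by blast
    next
      case False
      then obtain w where w: "w \<in> V" "w \<notin> K" "\<forall>x\<in>K - {v}. E w x"
        using K K' True assms(2) unfolding max_cliques_on_def by auto
      have "\<not> E v w"
      proof
        assume "E v w"
        then have "\<forall>x\<in>K. E w x"
          using w assms(1) by (auto dest: sympD)
        then show False
          using w K by (auto simp: max_cliques_on_def)
      qed
      have m: "\<exists>y\<in>K - {v}. \<not> E x y" if x: "x \<in> V" "E v x" "x \<notin> K" for x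
      proof -
        have "\<forall>x\<in>insert v V - K. \<exists>y\<in>K. \<not> E x y"
          using K by (simp add: max_cliques_on_def)
        then obtain y where y: "y \<in> K" "\<not> E x y"
          using x by blast
        then show ?thesis
          using sympD[OF assms(1) x(2)] by blast
      qed
      have "K - {v} \<subseteq> {x \<in> V. E v x \<and> E w x}"
        using K' w by blast
      moreover have "\<forall>x\<in>K - {v}. \<forall>y\<in>K - {v}. x \<noteq> y \<longrightarrow> E x y"
        using K by (simp add: max_cliques_on_def)
      moreover have "\<forall>x\<in>{x \<in> V. E v x \<and> E w x} - (K - {v}). \<exists>y\<in>K - {v}. \<not> E x y"
        using m assms(2) by blast
      ultimately have "K - {v} \<in> max_cliques_on E {x \<in> V. E v x \<and> E w x}"
        unfolding max_cliques_on_def by simp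
      then have "K \<in> insert v ` max_cliques_on E {x \<in> V. E v x \<and> E w x}"
        using K'(1) by (rule image_eqI[rotated])
      then show ?thesis using w(1) \<open>\<not> E v w\<close> by blast
    qed
  qed
qed

text \<open>Without any non-adjacent pair, \<open>V\<close> is the only maximal clique. Otherwise
  vertices are added one by one, and each contributes at most \<open>card V\<close> neighbourhoods
  to which the induction hypothesis for \<open>k\<close> applies.\<close>

lemma card_max_cliques_on_le:
  assumes "finite V" "symp E" "\<not> comatching_on E (Suc k) V"
  shows "card (max_cliques_on E V) \<le> (1 + card V * card V) ^ k"
  using assms(1,3)
proof (induction k arbitrary: V)
  case 0
  have "K = V" if "K \<in> max_cliques_on E V" for K
  proof -
    have K: "K \<subseteq> V" "\<forall>v\<in>V - K. \<exists>x\<in>K. \<not> E v x"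
      using that by (auto simp: max_cliques_on_def)
    have "v \<in> K" if v: "v \<in> V" for v
    proof (rule ccontr)
      assume "v \<notin> K"
      then obtain x where "x \<in> K" "\<not> E v x"
        using K(2) v by auto
      then have "x \<in> V" "v \<noteq> x"
        using K(1) \<open>v \<notin> K\<close> by auto
      then have "comatching_on E (Suc 0) V"
        using v \<open>\<not> E v x\<close> by auto
      then show False
        using 0(2) by contradiction
    qed
    then show ?thesis
      using K(1) by auto
  qed
  then have "max_cliques_on E V \<subseteq> {V}" by auto
  then show ?case
    using card_mono[of "{V}" "max_cliques_on E V"] by simp
next
  case (Suc k)
  let ?B = "(1 + card V * card V) ^ k"
  \<comment> \<open>The factor refers to the fixed \<open>V\<close> instead of \<open>U\<close>, so
    that each added vertex costs the same.\<close>
  have "card (max_cliques_on E U) \<le> 1 + card U * (card V * ?B)" if "U \<subseteq> V" for U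
    using finite_subset[OF that Suc.prems(1)] that
  proof (induction U)
    case empty
    show ?case by simp
  next
    case (insert v U)
    let ?N = "{w \<in> U. \<not> E v w}"
    let ?M = "\<lambda>w. max_cliques_on E {x \<in> U. E v x \<and> E w x}"
    let ?P = "{K \<in> max_cliques_on E U. \<exists>x\<in>K. \<not> E v x}"
    let ?Q = "{K \<in> max_cliques_on E U. \<forall>x\<in>K. E v x}"
    have fin: "finite (max_cliques_on E U)"
      using insert by (simp add: finite_max_cliques_on)
    have M: "card (?M w) \<le> ?B" if "w \<in> ?N" for w
    proof -
      let ?W = "{x \<in> U. E v x \<and> E w x}"
      have "\<not> comatching_on E (Suc k) ?W"
      proof
        assume "comatching_on E (Suc k) ?W"
        then have "comatching_on E (Suc k) {x \<in> V. E v x \<and> E w x}"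
          by (rule comatching_on_mono) (use insert in auto)
        moreover have "v \<in> V" "w \<in> V" "v \<noteq> w" "\<not> E v w"
          using insert that by auto
        ultimately show False
          using Suc.prems(2) unfolding comatching_on.simps(2)[of _ "Suc k"] by blast
      qed
      then have "card (?M w) \<le> (1 + card ?W * card ?W) ^ k"
        using Suc.IH[of ?W] insert by auto
      also have "card ?W \<le> card V"
        using insert Suc.prems(1) by (intro card_mono) auto
      then have "(1 + card ?W * card ?W) ^ k \<le> ?B"
        by (intro power_mono add_mono mult_mono) auto
      finally show ?thesis .
    qed
    have "card (max_cliques_on E (insert v U)) \<le>
        card (?P \<union> insert v ` ?Q \<union> (\<Union>w\<in>?N. insert v ` ?M w))"
      by (intro card_mono max_cliques_on_insert_subset)
        (use insert fin assms(2) in \<open>auto intro!: finite_max_cliques_on\<close>)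
    also have "\<dots> \<le> card (?P \<union> insert v ` ?Q) + card (\<Union>w\<in>?N. insert v ` ?M w)"
      by (rule card_Un_le)
    also have "card (?P \<union> insert v ` ?Q) \<le> card ?P + card ?Q"
      using card_Un_le[of ?P "insert v ` ?Q"] card_image_le[of ?Q "insert v"] fin by auto
    \<comment> \<open>The first two parts come from disjoint sets of old cliques, so together they
      cost no more than the old number; counting them separately would double it in each
      step.\<close>
    also have "card ?P + card ?Q = card (?P \<union> ?Q)"
      by (rule card_Un_disjoint[symmetric]) (use fin in auto)
    also have "?P \<union> ?Q = max_cliques_on E U"
      by auto
    also have "card (\<Union>w\<in>?N. insert v ` ?M w) \<le> (\<Sum>w\<in>?N. card (insert v ` ?M w))"
      using insert by (intro card_UN_le) auto
    also have "\<dots> \<le> (\<Sum>w\<in>?N. ?B)"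
    proof (intro sum_mono)
      fix w assume "w \<in> ?N"
      then show "card (insert v ` ?M w) \<le> ?B"
        using M[of w] card_image_le[of "?M w" "insert v"] insert
          finite_max_cliques_on[of "{x \<in> U. E v x \<and> E w x}" E] by simp
    qed
    also have "\<dots> = card ?N * ?B"
      by simp
    also have "card ?N \<le> card V"
      using insert Suc.prems(1) by (intro card_mono) auto
    finally have "card (max_cliques_on E (insert v U)) \<le> card (max_cliques_on E U) + card V * ?B"
      by simp
    also have "\<dots> \<le> 1 + card (insert v U) * (card V * ?B)"
      using insert by simp
    finally show ?case .
  qed
  from this[of V] have "card (max_cliques_on E V) \<le> 1 + (card V * card V) * ?B"
    by (simp add: mult.assoc)
  also have "\<dots> \<le> ?B + (card V * card V) * ?B"
    by (intro add_mono) auto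
  finally show ?case
    by (simp add: algebra_simps)
qed

section \<open>Balls avoiding a set and shallow clique minors\<close>

text \<open>The ball of radius \<open>r\<close> around \<open>a\<close> after deletion of
  \<open>S\<close>, empty if \<open>a\<close> itself is deleted. With \<open>S = - X\<close> it is
  the ball inside \<open>X\<close>.\<close>

primrec reach :: "('a \<Rightarrow> 'a \<Rightarrow> bool) \<Rightarrow> 'a set \<Rightarrow> nat \<Rightarrow> 'a \<Rightarrow> 'a set" where
  "reach E S 0 a = {a} - S"
| "reach E S (Suc r) a = reach E S r a \<union> {v. v \<notin> S \<and> (\<exists>u\<in>reach E S r a. E u v)}"

lemma reach_avoids: "v \<in> reach E S r a \<Longrightarrow> v \<notin> S"
  by (induction r arbitrary: v) auto

lemma reach_mono_radius: "r \<le> s \<Longrightarrow> reach E S r a \<subseteq> reach E S s a"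
  by (rule lift_Suc_mono_le[of "\<lambda>r. reach E S r a"]) auto

lemma reach_antimono: "S \<subseteq> T \<Longrightarrow> reach E T r a \<subseteq> reach E S r a"
proof (induction r)
  case (Suc r)
  then show ?case by fastforce
qed auto

lemma centre_in_reach: "a \<notin> S \<Longrightarrow> a \<in> reach E S r a"
  by (induction r) auto

text \<open>Initial segments of a walk of length at most \<open>r\<close> stay in the ball, so the
  ball has radius at most \<open>r\<close> on its own. This is what makes balls usable as branch
  sets.\<close>

lemma reach_within_itself: "k \<le> r \<Longrightarrow> reach E S k a \<subseteq> reach E (- reach E S r a) k a"
proof (induction k)
  case 0
  then show ?case using centre_in_reach[of a S E r] by auto
next
  case (Suc k)
  have "reach E S (Suc k) a \<subseteq> reach E S r a"
    using Suc.prems by (rule reach_mono_radius)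
  moreover have "reach E S k a \<subseteq> reach E (- reach E S r a) k a"
    using Suc by simp
  ultimately show ?case by auto
qed

lemma reach_insert: "v \<notin> reach E S r a \<Longrightarrow> reach E (insert v S) r a = reach E S r a"
proof (induction r)
  case (Suc r)
  then show ?case by auto
qed auto

lemma reach_trans: "w \<in> reach E S q x \<Longrightarrow> v \<in> reach E S p w \<Longrightarrow> v \<in> reach E S (q + p) x"
proof (induction p arbitrary: v)
  case 0
  then show ?case using reach_avoids[of w E S q x] by auto
next
  case (Suc p)
  then show ?case by auto
qed

text \<open>The two radii add up to \<open>d\<close>, so the half that starts in \<open>S\<close>
  can later be joined to a first half from another vertex without exceeding
  \<open>d\<close>.\<close>

lemma reach_through:
  assumes "v \<in> reach E {} d x" "x \<notin> S"
  shows "v \<in> reach E S d x \<or> (\<exists>w\<in>S. \<exists>q\<le>d. w \<in> reach E {} q x \<and> v \<in> reach E {} (d - q) w)"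
  using assms(1)
proof (induction d arbitrary: v)
  case 0
  then show ?case using assms(2) by auto
next
  case (Suc d)
  show ?case
  proof (cases "v \<in> S")
    case True
    then show ?thesis
      using Suc.prems by (intro disjI2 bexI[of _ v] exI[of _ "Suc d"]) auto
  next
    case False
    from Suc.prems obtain u where u: "u \<in> reach E {} d x" "u = v \<or> E u v"
      by auto
    from Suc.IH[OF u(1)] show ?thesis
    proof
      assume "u \<in> reach E S d x"
      then show ?thesis using u(2) False by auto
    next
      assume "\<exists>w\<in>S. \<exists>q\<le>d. w \<in> reach E {} q x \<and> u \<in> reach E {} (d - q) w"
      then obtain w q where w: "w \<in> S" "q \<le> d" "w \<in> reach E {} q x" "u \<in> reach E {} (d - q) w"
        by auto
      have "v \<in> reach E {} (Suc (d - q)) w"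
        using w(4) u(2) by auto
      then have "v \<in> reach E {} (Suc d - q) w"
        using w(2) by (simp add: Suc_diff_le)
      then show ?thesis
        using w by (intro disjI2 bexI[of _ w] exI[of _ q]) auto
    qed
  qed
qed

text \<open>A complete minor of order \<open>t\<close> given by its branch sets and their centres,
  with no reference to a vertex set. For \<open>t \<le> 1\<close> it carries no information about
  edges.\<close>

definition clique_minor :: "('a \<Rightarrow> 'a \<Rightarrow> bool) \<Rightarrow> nat \<Rightarrow> nat \<Rightarrow> bool" where
  "clique_minor E r t \<longleftrightarrow> (\<exists>X c. \<forall>i<t. c i \<in> X i \<and> X i \<subseteq> reach E (- X i) r (c i) \<and>
     (\<forall>j<t. i \<noteq> j \<longrightarrow> X i \<inter> X j = {} \<and> (\<exists>x\<in>X i. \<exists>y\<in>X j. E x y)))"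

lemma clique_minorI:
  assumes "finite I" "t \<le> card I"
    and "\<And>i. i \<in> I \<Longrightarrow> c i \<in> X i" "\<And>i. i \<in> I \<Longrightarrow> X i \<subseteq> reach E (- X i) r (c i)"
    and "\<And>i j. i \<in> I \<Longrightarrow> j \<in> I \<Longrightarrow> i \<noteq> j \<Longrightarrow> X i \<inter> X j = {}"
    and "\<And>i j. i \<in> I \<Longrightarrow> j \<in> I \<Longrightarrow> i \<noteq> j \<Longrightarrow> \<exists>x\<in>X i. \<exists>y\<in>X j. E x y"
  shows "clique_minor E r t"
proof -
  obtain h where h: "bij_betw h {0..<card I} I"
    using ex_bij_betw_nat_finite[OF assms(1)] by blast
  then have hI: "h i \<in> I" if "i < t" for i
    using that assms(2) by (auto simp: bij_betw_def)
  have inj: "h i \<noteq> h j" if "i < t" "j < t" "i \<noteq> j" for i j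
    using that assms(2) h by (auto simp: bij_betw_def inj_on_def)
  show ?thesis
    unfolding clique_minor_def
    by (rule exI[of _ "X \<circ> h"], rule exI[of _ "c \<circ> h"])
      (use hI inj assms(3-6) in \<open>simp\<close>)
qed

text \<open>For symmetric \<open>E\<close> this says that distances after deletion of
  \<open>S\<close> exceed \<open>2 * r\<close>. Disjointness of balls is the form needed to turn the
  balls into branch sets.\<close>

definition scattered :: "('a \<Rightarrow> 'a \<Rightarrow> bool) \<Rightarrow> 'a set \<Rightarrow> nat \<Rightarrow> 'a set \<Rightarrow> bool" where
  "scattered E S r A \<longleftrightarrow>
     A \<inter> S = {} \<and> (\<forall>a\<in>A. \<forall>b\<in>A. a \<noteq> b \<longrightarrow> reach E S r a \<inter> reach E S r b = {})"

lemma scattered_subset: "scattered E S r A \<Longrightarrow> B \<subseteq> A \<Longrightarrow> scattered E S r B"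
  unfolding scattered_def by blast

text \<open>The library theorem colours unordered sets; reading the colour from the increasing
  enumeration lets it depend on the order of the three indices.\<close>

lemma ramsey_triples:
  "\<exists>N. \<forall>col :: nat \<Rightarrow> nat \<Rightarrow> nat \<Rightarrow> nat. (\<forall>i j k. col i j k < q) \<longrightarrow>
     (\<exists>H\<subseteq>{..<N}. card H = M \<and>
        (\<exists>c<q. \<forall>i\<in>H. \<forall>j\<in>H. \<forall>k\<in>H. i < j \<longrightarrow> j < k \<longrightarrow> col i j k = c))"
proof -
  obtain N :: nat where N: "partn_lst {..<N} (replicate q M) 3"
    using ramsey_full by blast
  have "\<exists>H\<subseteq>{..<N}. card H = M \<and>
      (\<exists>c<q. \<forall>i\<in>H. \<forall>j\<in>H. \<forall>k\<in>H. i < j \<longrightarrow> j < k \<longrightarrow> col i j k = c)"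
    if col: "\<forall>i j k. col i j k < q" for col :: "nat \<Rightarrow> nat \<Rightarrow> nat \<Rightarrow> nat"
  proof -
    define f where "f = (\<lambda>X. let l = sorted_list_of_set X in col (l ! 0) (l ! 1) (l ! 2))"
    have "f \<in> nsets {..<N} 3 \<rightarrow> {..<q}"
      using col by (auto simp: f_def Let_def)
    then obtain c H where cH: "c < q" "H \<in> nsets {..<N} (replicate q M ! c)" "f ` nsets H 3 \<subseteq> {c}"
      using partn_lstE[OF N] by (metis length_replicate)
    have "col i j k = c" if "i \<in> H" "j \<in> H" "k \<in> H" "i < j" "j < k" for i j k
    proof -
      have "{i, j, k} \<in> nsets H 3"
        using that by (auto simp: nsets_def)
      then have "f {i, j, k} = c"
        using cH(3) by blast
      moreover have "sorted_list_of_set {i, j, k} = [i, j, k]"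
        using that by (intro sorted_list_of_set_unique[THEN iffD1]) auto
      ultimately show ?thesis
        by (simp add: f_def)
    qed
    then show ?thesis
      using cH(1,2) by (intro exI[of _ H]) (auto simp: nsets_def)
  qed
  then show ?thesis by blast
qed

section \<open>Uniform quasi-wideness\<close>

text \<open>
  One application of Ramsey's theorem to triples. The vertex \<open>w i j\<close> below is a common neighbour of
  two balls. If it sees no third ball, these vertices subdivide the edges of a clique on the balls;
  otherwise homogeneity produces a single vertex that sees many balls.
\<close>

lemma wideness_step:
  "\<exists>N. \<forall>(E :: 'a \<Rightarrow> 'a \<Rightarrow> bool) S A. symp E \<longrightarrow> finite A \<longrightarrow> N \<le> card A \<longrightarrow> scattered E S r A \<longrightarrow>
     clique_minor E (Suc r) t \<or>
     (\<exists>B\<subseteq>A. card B = m \<and> scattered E S (Suc r) B) \<or>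
     (\<exists>B\<subseteq>A. card B = m \<and> (\<exists>v. v \<notin> S \<and> (\<forall>a\<in>B. v \<notin> reach E S r a \<and> (\<exists>u\<in>reach E S r a. E u v))))"
proof -
  \<comment> \<open>One index is reserved as a third index for pairs and two may be used up by the
    pair that defines a hub; at least \<open>t\<close> and at least \<open>m\<close> indices have to
    remain.\<close>
  let ?M = "t + m + 3"
  obtain N where N: "\<And>col :: nat \<Rightarrow> nat \<Rightarrow> nat \<Rightarrow> nat. (\<forall>i j k. col i j k < 6) \<Longrightarrow>
     (\<exists>H\<subseteq>{..<N}. card H = ?M \<and>
        (\<exists>c<6. \<forall>i\<in>H. \<forall>j\<in>H. \<forall>k\<in>H. i < j \<longrightarrow> j < k \<longrightarrow> col i j k = c))"
    using ramsey_triples[of 6 ?M] by blast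
  have "clique_minor E (Suc r) t \<or>
     (\<exists>B\<subseteq>A. card B = m \<and> scattered E S (Suc r) B) \<or>
     (\<exists>B\<subseteq>A. card B = m \<and> (\<exists>v. v \<notin> S \<and> (\<forall>a\<in>B. v \<notin> reach E S r a \<and> (\<exists>u\<in>reach E S r a. E u v))))"
    (is "?minor \<or> ?wide \<or> ?hub")
    if E: "symp E" and A: "finite A" "N \<le> card A" "scattered E S r A"
    for E :: "'a \<Rightarrow> 'a \<Rightarrow> bool" and S A
  proof -
    obtain a where a: "inj_on a {..<N}" "a ` {..<N} \<subseteq> A"
      using card_le_inj[of "{..<N}" A] A by auto
    define R where "R i = reach E S r (a i)" for i
    define R' where "R' i = reach E S (Suc r) (a i)" for i
    define adj where "adj i v \<longleftrightarrow> (\<exists>u\<in>R i. E u v)" for i v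
    define touch where "touch i j \<longleftrightarrow> (\<exists>v\<in>R j. adj i v)" for i j
    define w where "w i j = (SOME v. v \<in> R' i \<inter> R' j)" for i j
    \<comment> \<open>Colours 0 and 1 concern the first two balls only: they are joined by an edge,
      or their enlargements are disjoint. In colours 2, 3 and 4 the connector \<open>w\<close> of
      two balls also sees the third, whose index is the largest, the middle or the smallest one; in
      colour 5 no connector does.\<close>
    define col :: "nat \<Rightarrow> nat \<Rightarrow> nat \<Rightarrow> nat" where
      "col i j k = (if touch i j then 0 else if R' i \<inter> R' j = {} then 1 else if adj k (w i j) then 2
         else if adj j (w i k) then 3 else if adj i (w j k) then 4 else 5)" for i j k
    have col0: "touch i j" if "col i j k = 0" for i j k
      using that by (simp add: col_def split: if_splits)
    have col1: "R' i \<inter> R' j = {}" if "col i j k = 1" for i j k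
      using that by (simp add: col_def split: if_splits)
    have col_ge2: "\<not> touch i j" "R' i \<inter> R' j \<noteq> {}" if "2 \<le> col i j k" for i j k
      using that by (simp_all add: col_def split: if_splits)
    have col2: "adj k (w i j)" if "col i j k = 2" for i j k
      using that by (simp add: col_def split: if_splits)
    have col3: "adj j (w i k)" if "col i j k = 3" for i j k
      using that by (simp add: col_def split: if_splits)
    have col4: "adj i (w j k)" if "col i j k = 4" for i j k
      using that by (simp add: col_def split: if_splits)
    have col5: "\<not> adj k (w i j)" "\<not> adj j (w i k)" "\<not> adj i (w j k)" if "col i j k = 5" for i j k
      using that by (simp_all add: col_def split: if_splits)
    have "\<forall>i j k. col i j k < 6"
      by (simp add: col_def)
    from N[OF this] obtain H where "H \<subseteq> {..<N} \<and> card H = ?M \<and>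
        (\<exists>c<6. \<forall>i\<in>H. \<forall>j\<in>H. \<forall>k\<in>H. i < j \<longrightarrow> j < k \<longrightarrow> col i j k = c)" ..
    then have H: "H \<subseteq> {..<N}" "card H = ?M"
      and "\<exists>c<6. \<forall>i\<in>H. \<forall>j\<in>H. \<forall>k\<in>H. i < j \<longrightarrow> j < k \<longrightarrow> col i j k = c" by simp_all
    then obtain c where "c < 6 \<and> (\<forall>i\<in>H. \<forall>j\<in>H. \<forall>k\<in>H. i < j \<longrightarrow> j < k \<longrightarrow> col i j k = c)"
      by (elim exE)
    then have "c < 6" and col_c: "\<forall>i\<in>H. \<forall>j\<in>H. \<forall>k\<in>H. i < j \<longrightarrow> j < k \<longrightarrow> col i j k = c"
      by simp_all
    have c: "col i j k = c" if "i \<in> H" "j \<in> H" "k \<in> H" "i < j" "j < k" for i j k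
      using col_c that by simp
    have "finite H"
      using H(1) finite_subset by auto
    have "H \<noteq> {}"
      using H(2) by auto
    then have MaxH: "Max H \<in> H"
      using \<open>finite H\<close> by (rule Max_in[rotated])
    \<comment> \<open>With \<open>Max H\<close> as third index, every pair in \<open>I\<close>
      belongs to a triple of colour \<open>c\<close>.\<close>
    define I where "I = H - {Max H}"
    have I: "I \<subseteq> H" "finite I" "card I = t + m + 2"
      using H(2) \<open>finite H\<close> MaxH by (auto simp: I_def)
    have c_in_I: "col i j k = c" if "i \<in> I" "j \<in> I" "k \<in> I" "i < j" "j < k" for i j k
      using that I(1) by (intro c) blast+
    have col_pair: "col i j (Max H) = c" if "i \<in> I" "j \<in> I" "i < j" for i j
    proof -
      have "j < Max H" "Max H \<in> H"
        using that(2) \<open>finite H\<close> Max_ge[of H j] MaxH by (auto simp: I_def intro: le_neq_trans)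
      then show ?thesis
        using c[of i j "Max H"] that I(1) by blast
    qed
    have a_neq: "a i \<noteq> a j" if "i \<in> I" "j \<in> I" "i \<noteq> j" for i j
      using a(1) that I(1) H(1) by (auto dest: inj_onD)
    have aA: "a i \<in> A" if "i \<in> I" for i
      using a(2) that I(1) H(1) by blast
    have aS: "a i \<notin> S" if "i \<in> I" for i
      using aA[OF that] A(3) by (auto simp: scattered_def)
    have R_disj: "R i \<inter> R j = {}" if "i \<in> I" "j \<in> I" "i \<noteq> j" for i j
      using A(3) aA a_neq that unfolding scattered_def R_def by blast
    have R_centre: "a i \<in> R i" if "i \<in> I" for i
      using aS[OF that] by (simp add: R_def centre_in_reach)
    have R_R: "R i \<subseteq> reach E (- R i) r (a i)" for i
      unfolding R_def by (rule reach_within_itself) simp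
    have card_a: "card (a ` B) = card B" if "B \<subseteq> I" for B
      using a_neq that by (intro card_image inj_onI) blast
    have pick: "\<exists>D\<subseteq>J. card D = m" if "m \<le> card J" for J :: "nat set"
      by (rule obtain_subset_with_card_n[OF that]) blast
    consider "c = 0" | "c = 1" | "2 \<le> c"
      by linarith
    then show ?thesis
    proof cases
      case 1
      have "touch i j" if "i \<in> I" "j \<in> I" "i < j" for i j
        using col_pair[OF that] 1 by (intro col0) simp
      then have touch: "\<exists>x\<in>R i. \<exists>y\<in>R j. E x y" if "i \<in> I" "j \<in> I" "i \<noteq> j" for i j
        using that sympD[OF E] unfolding touch_def adj_def by (metis linorder_neqE_nat)
      have ?minor
      proof (rule clique_minorI[of I t a R])
        show "R i \<subseteq> reach E (- R i) (Suc r) (a i)" for i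
          using R_R[of i] reach_mono_radius[of r "Suc r" E "- R i" "a i"] by auto
      qed (use I R_centre R_disj touch in auto)
      then show ?thesis ..
    next
      case 2
      have disj: "R' i \<inter> R' j = {}" if "i \<in> I" "j \<in> I" "i < j" for i j
        using col_pair[OF that] 2 by (intro col1) simp
      have disj': "R' i \<inter> R' j = {}" if "i \<in> I" "j \<in> I" "i \<noteq> j" for i j
        using disj[of i j] disj[of j i] that by (cases "i < j") auto
      obtain D where D: "D \<subseteq> I" "card D = m"
        using pick[of I] I(3) by auto
      have "scattered E S (Suc r) (a ` D)"
        unfolding scattered_def
      proof (intro conjI ballI impI)
        show "a ` D \<inter> S = {}"
          using D aS by auto
        fix x y assume "x \<in> a ` D" "y \<in> a ` D" "x \<noteq> y"
        then obtain i j where ij: "i \<in> I" "j \<in> I" "i \<noteq> j" "x = a i" "y = a j"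
          using D(1) by blast
        show "reach E S (Suc r) x \<inter> reach E S (Suc r) y = {}"
          using disj'[OF ij(1-3)] by (simp only: R'_def ij(4,5))
      qed
      moreover have "a ` D \<subseteq> A" "card (a ` D) = m"
        using D aA card_a by auto
      ultimately show ?thesis by blast
    next
      case 3
      have pair: "\<not> touch i j" "R' i \<inter> R' j \<noteq> {}" if "i \<in> I" "j \<in> I" "i < j" for i j
        using col_ge2[of i j "Max H"] col_pair[OF that] 3 by simp_all
      have not_touch: "\<not> touch i j" if "i \<in> I" "j \<in> I" "i \<noteq> j" for i j
      proof (cases "i < j")
        case False
        then have "\<not> touch j i" using pair(1) that by simp
        then show ?thesis
          using sympD[OF E] unfolding touch_def adj_def by blast
      qed (use pair(1) that in simp)
      \<comment> \<open>A connector inside some ball would make that ball touch another one, which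
        colours from 2 on exclude.\<close>
      have w: "w i j \<notin> S" "adj i (w i j)" "adj j (w i j)" "\<And>l. l \<in> I \<Longrightarrow> w i j \<notin> R l"
        if ij: "i \<in> I" "j \<in> I" "i < j" for i j
      proof -
        let ?v = "w i j"
        have v: "?v \<in> R' i" "?v \<in> R' j"
          using pair(2)[OF ij] someI_ex[of "\<lambda>v. v \<in> R' i \<inter> R' j"] by (auto simp: w_def)
        have split: "?v \<in> R k \<or> ?v \<notin> S \<and> adj k ?v" if "?v \<in> R' k" for k
          using that by (auto simp: R'_def R_def adj_def)
        have "i \<noteq> j" using ij by simp
        have "?v \<notin> R i"
          using R_disj[OF ij(1,2) \<open>i \<noteq> j\<close>] split[OF v(2)] not_touch[OF ij(2,1)] \<open>i \<noteq> j\<close>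
          by (auto simp: touch_def)
        moreover have "?v \<notin> R j"
          using R_disj[OF ij(1,2) \<open>i \<noteq> j\<close>] split[OF v(1)] not_touch[OF ij(1,2)] \<open>i \<noteq> j\<close>
          by (auto simp: touch_def)
        ultimately show "?v \<notin> S" "adj i ?v" "adj j ?v"
          using split[OF v(1)] split[OF v(2)] by auto
        show "?v \<notin> R l" if "l \<in> I" for l
        proof (cases "l = i")
          case False
          then show ?thesis
            using not_touch[of i l] ij that \<open>adj i ?v\<close> by (auto simp: touch_def)
        qed (use \<open>?v \<notin> R i\<close> in simp)
      qed
      have hub: ?hub if "i \<in> I" "j \<in> I" "i < j" "J \<subseteq> I" "m \<le> card J" "\<And>k. k \<in> J \<Longrightarrow> adj k (w i j)" for i j J
      proof -
        obtain D where D: "D \<subseteq> J" "card D = m"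
          using pick[OF \<open>m \<le> card J\<close>] by auto
        have "w i j \<notin> reach E S r x \<and> (\<exists>u\<in>reach E S r x. E u (w i j))" if "x \<in> a ` D" for x
        proof -
          from that obtain k where k: "k \<in> D" "x = a k" by blast
          have "k \<in> J" "k \<in> I" using k(1) D(1) \<open>J \<subseteq> I\<close> by auto
          then have "w i j \<notin> R k" "adj k (w i j)"
            using w(4)[OF \<open>i \<in> I\<close> \<open>j \<in> I\<close> \<open>i < j\<close>] \<open>\<And>k. k \<in> J \<Longrightarrow> adj k (w i j)\<close> by auto
          then show ?thesis
            unfolding k(2) adj_def R_def by simp
        qed
        moreover have "a ` D \<subseteq> A" "card (a ` D) = m"
          using D \<open>J \<subseteq> I\<close> aA card_a[of D] by auto
        ultimately show ?hub
          using w(1)[OF that(1-3)] by blast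
      qed
      \<comment> \<open>For colours 2, 3 and 4 the hub comes from the two smallest, the two extreme
        and the two largest indices: then every other index stands in the position of the ball that
        the connector also sees.\<close>
      define x where "x = Min I"
      define z where "z = Max I"
      have "I \<noteq> {}" using I(3) by auto
      then have xz: "x \<in> I" "z \<in> I" "\<And>k. k \<in> I \<Longrightarrow> x \<le> k" "\<And>k. k \<in> I \<Longrightarrow> k \<le> z"
        using I(2) by (auto simp: x_def z_def)
      define y where "y = Min (I - {x})"
      define y' where "y' = Max (I - {z})"
      have "card (I - {x}) \<noteq> 0" "card (I - {z}) \<noteq> 0"
        using I xz by auto
      then have "I - {x} \<noteq> {}" "I - {z} \<noteq> {}"
        by (metis card.empty)+
      then have y: "y \<in> I - {x}" "\<And>k. k \<in> I - {x} \<Longrightarrow> y \<le> k" "y' \<in> I - {z}" "\<And>k. k \<in> I - {z} \<Longrightarrow> k \<le> y'"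
        using Min_in[of "I - {x}"] Max_in[of "I - {z}"] Min_le[of "I - {x}"] Max_ge[of "I - {z}"] I(2)
        by (auto simp only: y_def y'_def finite_Diff)
      have yI: "y \<in> I" "y' \<in> I"
        using y(1,3) by blast+
      have remaining: "m \<le> card (I - {p, q})" for p q
        using diff_card_le_card_Diff[of "{p, q}" I] I(3) by (simp add: card_insert_if split: if_splits)
      have "x \<noteq> z"
        using y(1) xz(3)[of y] xz(4)[of y] by auto
      consider "c = 2" | "c = 3" | "c = 4" | "c = 5"
        using 3 \<open>c < 6\<close> by linarith
      then show ?thesis
      proof cases
        case 1
        have lt: "x < y" using yI(1) y(1) xz(3)[of y] by auto
        have "adj k (w x y)" if "k \<in> I - {x, y}" for k
        proof (rule col2)
          have k: "k \<in> I" "y < k" using that y(2)[of k] by auto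
          show "col x y k = 2"
            using c_in_I[OF xz(1) yI(1) k(1) lt k(2)] 1 by simp
        qed
        then have ?hub
          by (rule hub[OF xz(1) yI(1) lt Diff_subset remaining])
        then show ?thesis by blast
      next
        case 2
        have lt: "x < z" using \<open>x \<noteq> z\<close> xz(3)[of z] xz(2) by auto
        have "adj k (w x z)" if "k \<in> I - {x, z}" for k
        proof (rule col3)
          have k: "k \<in> I" "x < k" "k < z" using that xz(3)[of k] xz(4)[of k] by auto
          show "col x k z = 3"
            using c_in_I[OF xz(1) k(1) xz(2) k(2,3)] 2 by simp
        qed
        then have ?hub
          by (rule hub[OF xz(1,2) lt Diff_subset remaining])
        then show ?thesis by blast
      next
        case 3
        have lt: "y' < z" using yI(2) y(3) xz(4)[of y'] by auto
        have "adj k (w y' z)" if "k \<in> I - {y', z}" for k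
        proof (rule col4)
          have k: "k \<in> I" "k < y'" using that y(4)[of k] by auto
          show "col k y' z = 4"
            using c_in_I[OF k(1) yI(2) xz(2) k(2) lt] 3 by simp
        qed
        then have ?hub
          by (rule hub[OF yI(2) xz(2) lt Diff_subset remaining])
        then show ?thesis by blast
      next
        case 4
        have only: "\<not> adj l (w i j)" if "i \<in> I" "j \<in> I" "i < j" "l \<in> I" "l \<noteq> i" "l \<noteq> j" for i j l
        proof -
          consider "l < i" | "i < l" "l < j" | "j < l"
            using \<open>l \<noteq> i\<close> \<open>l \<noteq> j\<close> by linarith
          then show ?thesis
          proof cases
            case 1
            have "col l i j = 5"
              using c_in_I[OF \<open>l \<in> I\<close> \<open>i \<in> I\<close> \<open>j \<in> I\<close> 1 \<open>i < j\<close>] 4 by simp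
            then show ?thesis by (rule col5)
          next
            case 2
            have "col i l j = 5"
              using c_in_I[OF \<open>i \<in> I\<close> \<open>l \<in> I\<close> \<open>j \<in> I\<close> 2] 4 by simp
            then show ?thesis by (rule col5)
          next
            case 3
            have "col i j l = 5"
              using c_in_I[OF \<open>i \<in> I\<close> \<open>j \<in> I\<close> \<open>l \<in> I\<close> \<open>i < j\<close> 3] 4 by simp
            then show ?thesis by (rule col5)
          qed
        qed
        \<comment> \<open>A connector goes to the branch set of its smaller index. It is adjacent to
          the ball of that index, so the radius grows by only one.\<close>
        define X where "X i = R i \<union> {w i j |j. j \<in> I \<and> i < j}" for i
        have "clique_minor E (Suc r) t"
        proof (rule clique_minorI[of I t a X])
          show "a i \<in> X i" if "i \<in> I" for i
            using R_centre[OF that] by (simp add: X_def)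
          show "X i \<subseteq> reach E (- X i) (Suc r) (a i)" if "i \<in> I" for i
          proof -
            have "R i \<subseteq> reach E (- X i) r (a i)"
              using R_R[of i] reach_antimono[of "- X i" "- R i" E r "a i"] by (auto simp: X_def)
            moreover have "\<exists>u\<in>R i. E u (w i j)" if "j \<in> I" "i < j" for j
              using w(2)[OF \<open>i \<in> I\<close> that] by (simp add: adj_def)
            moreover have "\<not> w i j \<in> - X i" if "j \<in> I" "i < j" for j
              using that by (auto simp: X_def)
            ultimately have "v \<in> reach E (- X i) (Suc r) (a i)" if "v \<in> X i" for v
              using that unfolding X_def[of i] reach.simps(2) by blast
            then show ?thesis by blast
          qed
          show "X i \<inter> X j = {}" if ij: "i \<in> I" "j \<in> I" "i \<noteq> j" for i j
          proof -
            \<comment> \<open>In colour 5 a connector sees only its own two balls, so a common value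
              would force the pairs \<open>{i, k}\<close> and \<open>{j, l}\<close> to coincide;
              both are listed in increasing order and \<open>i \<noteq> j\<close>.\<close>
            have "w i k \<noteq> w j l" if "k \<in> I" "i < k" "l \<in> I" "j < l" for k l
            proof
              assume eq: "w i k = w j l"
              have "adj j (w i k)" "adj l (w i k)"
                using w(2,3)[OF ij(2) that(3,4)] eq by auto
              then have "j \<in> {i, k}" "l \<in> {i, k}"
                using only ij that by blast+
              then show False using ij(3) that by auto
            qed
            moreover have "w i k \<notin> R j" if "k \<in> I" "i < k" for k
              using w(4)[OF ij(1) that ij(2)] .
            moreover have "w j k \<notin> R i" if "k \<in> I" "j < k" for k
              using w(4)[OF ij(2) that ij(1)] .
            moreover have "R i \<inter> R j = {}"
              using R_disj ij by blast
            ultimately show ?thesis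
              unfolding X_def by blast
          qed
          show "\<exists>x\<in>X i. \<exists>y\<in>X j. E x y" if ij: "i \<in> I" "j \<in> I" "i \<noteq> j" for i j
          proof (cases "i < j")
            case True
            then obtain u where "u \<in> R j" "E u (w i j)"
              using w(3)[OF ij(1,2)] by (auto simp: adj_def)
            moreover have "w i j \<in> X i" using True ij by (auto simp: X_def)
            ultimately show ?thesis
              using sympD[OF E] by (auto simp: X_def)
          next
            case False
            then have "j < i" using ij by simp
            then obtain u where "u \<in> R i" "E u (w j i)"
              using w(3)[OF ij(2,1)] by (auto simp: adj_def)
            moreover have "w j i \<in> X j" using \<open>j < i\<close> ij by (auto simp: X_def)
            ultimately show ?thesis by (auto simp: X_def)
          qed
        qed (use I in auto)
        then show ?thesis ..
      qed
    qed
  qed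
  then show ?thesis by blast
qed

text \<open>
  The set \<open>T\<close> collects the vertices that see all remaining balls. As soon as there are \<open>t\<close> of them,
  a matching between \<open>T\<close> and the balls can be contracted to a clique.
\<close>

lemma wideness_iteration:
  "\<exists>N. \<forall>(E :: 'a \<Rightarrow> 'a \<Rightarrow> bool) S A T. symp E \<longrightarrow> finite A \<longrightarrow> N \<le> card A \<longrightarrow> scattered E S r A \<longrightarrow>
     finite S \<longrightarrow> T \<subseteq> S \<longrightarrow> t \<le> card T + l \<longrightarrow> (\<forall>w\<in>T. \<forall>a\<in>A. \<exists>u\<in>reach E S r a. E u w) \<longrightarrow>
     clique_minor E (Suc r) t \<or>
     (\<exists>S' B. finite S' \<and> card S' \<le> card S + l \<and> B \<subseteq> A \<and> card B = m \<and> scattered E S' (Suc r) B)"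
\<comment> \<open>\<open>l\<close> bounds how many hubs are missing until \<open>T\<close> has
  \<open>t\<close> elements, and is also the number of vertices that may still be deleted.\<close>
proof (induction l)
  case 0
  have "clique_minor E (Suc r) t"
    if E: "symp E" and A: "finite A" "t \<le> card A" "scattered E S r A"
      and T: "finite S" "T \<subseteq> S" "t \<le> card T" "\<forall>w\<in>T. \<forall>a\<in>A. \<exists>u\<in>reach E S r a. E u w"
    for E :: "'a \<Rightarrow> 'a \<Rightarrow> bool" and S A T
  proof -
    obtain a where a: "inj_on a {..<t}" "a ` {..<t} \<subseteq> A"
      using card_le_inj[of "{..<t}" A] A by auto
    have "finite T" using T finite_subset by blast
    then obtain w where w: "inj_on w {..<t}" "w ` {..<t} \<subseteq> T"
      using card_le_inj[of "{..<t}" T] T by auto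
    define X where "X i = insert (w i) (reach E S r (a i))" for i
    have aS: "a i \<notin> S" if "i < t" for i
      using a(2) A(3) that unfolding scattered_def by blast
    have wS: "w i \<in> S" if "i < t" for i
      using w(2) T(2) that by blast
    have adj: "\<exists>u\<in>reach E S r (a i). E u (w j)" if "i < t" "j < t" for i j
      using T(4) a(2) w(2) that by blast
    show ?thesis
    proof (rule clique_minorI[of "{..<t}" t a X])
      show "X i \<subseteq> reach E (- X i) (Suc r) (a i)" if "i \<in> {..<t}" for i
      proof -
        have "reach E S r (a i) \<subseteq> reach E (- reach E S r (a i)) r (a i)"
          by (rule reach_within_itself) simp
        also have "\<dots> \<subseteq> reach E (- X i) r (a i)"
          by (rule reach_antimono) (auto simp: X_def)
        finally show ?thesis
          using adj[of i i] that by (auto simp: X_def)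
      qed
      show "X i \<inter> X j = {}" if "i \<in> {..<t}" "j \<in> {..<t}" "i \<noteq> j" for i j
      proof -
        have "a i \<noteq> a j" "w i \<noteq> w j"
          using that a(1) w(1) by (auto dest: inj_onD)
        moreover have "reach E S r (a i) \<inter> reach E S r (a j) = {}"
          using A(3) a(2) that \<open>a i \<noteq> a j\<close> unfolding scattered_def by blast
        ultimately show ?thesis
          using wS[of i] wS[of j] that reach_avoids[of _ E S r] by (auto simp: X_def)
      qed
      show "\<exists>x\<in>X i. \<exists>y\<in>X j. E x y" if "i \<in> {..<t}" "j \<in> {..<t}" "i \<noteq> j" for i j
        using adj[of i j] that by (auto simp: X_def)
    qed (use aS in \<open>auto simp: X_def centre_in_reach\<close>)
  qed
  then show ?case by (intro exI[of _ t]) simp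
next
  case (Suc l)
  obtain N1 where N1: "\<And>(E :: 'a \<Rightarrow> 'a \<Rightarrow> bool) S A T. symp E \<Longrightarrow> finite A \<Longrightarrow> N1 \<le> card A \<Longrightarrow> scattered E S r A \<Longrightarrow>
     finite S \<Longrightarrow> T \<subseteq> S \<Longrightarrow> t \<le> card T + l \<Longrightarrow> (\<forall>w\<in>T. \<forall>a\<in>A. \<exists>u\<in>reach E S r a. E u w) \<Longrightarrow>
     clique_minor E (Suc r) t \<or>
     (\<exists>S' B. finite S' \<and> card S' \<le> card S + l \<and> B \<subseteq> A \<and> card B = m \<and> scattered E S' (Suc r) B)"
    using Suc.IH by blast
  \<comment> \<open>\<open>max m N1\<close> serves both outcomes: a scattered set is trimmed to
    \<open>m\<close>, while a hub leaves enough balls for the induction hypothesis.\<close>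
  obtain N where N: "\<And>(E :: 'a \<Rightarrow> 'a \<Rightarrow> bool) S A. symp E \<Longrightarrow> finite A \<Longrightarrow> N \<le> card A \<Longrightarrow> scattered E S r A \<Longrightarrow>
     clique_minor E (Suc r) t \<or>
     (\<exists>B\<subseteq>A. card B = max m N1 \<and> scattered E S (Suc r) B) \<or>
     (\<exists>B\<subseteq>A. card B = max m N1 \<and>
        (\<exists>v. v \<notin> S \<and> (\<forall>a\<in>B. v \<notin> reach E S r a \<and> (\<exists>u\<in>reach E S r a. E u v))))"
    using wideness_step[of r t "max m N1"] by blast
  have *: "clique_minor E (Suc r) t \<or>
     (\<exists>S' B. finite S' \<and> card S' \<le> card S + Suc l \<and> B \<subseteq> A \<and> card B = m \<and> scattered E S' (Suc r) B)"
    if E: "symp E" and A: "finite A" "N \<le> card A" "scattered E S r A"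
      and T: "finite S" "T \<subseteq> S" "t \<le> card T + Suc l" "\<forall>w\<in>T. \<forall>a\<in>A. \<exists>u\<in>reach E S r a. E u w"
    for E :: "'a \<Rightarrow> 'a \<Rightarrow> bool" and S A T
    using N[OF E A]
  proof (elim disjE)
    assume "\<exists>B\<subseteq>A. card B = max m N1 \<and> scattered E S (Suc r) B"
    then obtain B where B: "B \<subseteq> A" "card B = max m N1" "scattered E S (Suc r) B"
      by blast
    obtain D where "D \<subseteq> B" "card D = m"
      using obtain_subset_with_card_n[of m B] B(2) by auto
    then show ?thesis
      using B scattered_subset[of E S "Suc r" B D] T(1)
      by (intro disjI2 exI[of _ S] exI[of _ D]) auto
  next
    assume "\<exists>B\<subseteq>A. card B = max m N1 \<and>
        (\<exists>v. v \<notin> S \<and> (\<forall>a\<in>B. v \<notin> reach E S r a \<and> (\<exists>u\<in>reach E S r a. E u v)))"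
    then obtain B v where B: "B \<subseteq> A" "card B = max m N1" "v \<notin> S"
      "\<And>a. a \<in> B \<Longrightarrow> v \<notin> reach E S r a" "\<And>a. a \<in> B \<Longrightarrow> \<exists>u\<in>reach E S r a. E u v"
      by blast
    let ?S = "insert v S"
    \<comment> \<open>The hub lies outside the surviving balls, so deleting it changes none of
      them.\<close>
    have eq: "reach E ?S r a = reach E S r a" if "a \<in> B" for a
      using reach_insert[OF B(4)[OF that]] .
    have "v \<notin> B"
      using B(3) B(4)[of v] centre_in_reach[of v S E r] by blast
    have "clique_minor E (Suc r) t \<or>
      (\<exists>S' D. finite S' \<and> card S' \<le> card ?S + l \<and> D \<subseteq> B \<and> card D = m \<and> scattered E S' (Suc r) D)"
    proof (rule N1[OF E])
      show "finite B" using B(1) A(1) finite_subset by blast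
      show "N1 \<le> card B" using B(2) by simp
      show "scattered E ?S r B"
        using scattered_subset[OF A(3) B(1)] \<open>v \<notin> B\<close> eq by (simp add: scattered_def)
      show "finite ?S" "insert v T \<subseteq> ?S"
        using T by auto
      have "finite T" "v \<notin> T"
        using T B(3) finite_subset by blast+
      then show "t \<le> card (insert v T) + l"
        using T(3) by simp
      show "\<forall>w\<in>insert v T. \<forall>a\<in>B. \<exists>u\<in>reach E ?S r a. E u w"
      proof (intro ballI)
        fix w a assume "w \<in> insert v T" "a \<in> B"
        then show "\<exists>u\<in>reach E ?S r a. E u w"
          using B(1,5) T(4) eq by blast
      qed
    qed
    moreover have "card ?S = Suc (card S)"
      using B(3) T(1) by simp
    ultimately show ?thesis
      using B(1) by (metis add_Suc add_Suc_right order_trans)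
  qed simp
  show ?case
    by (intro exI[of _ N] allI impI) (rule *; assumption)
qed

text \<open>Induction on the radius. Each step starts the iteration with no hubs and a budget of
  \<open>t\<close>, so \<open>s\<close> grows by a number that depends on the excluded minor and not
  on \<open>m\<close>.\<close>

lemma uniformly_quasi_wide:
  fixes \<E> :: "('a \<Rightarrow> 'a \<Rightarrow> bool) set"
  assumes "\<And>r. \<exists>t. \<forall>E\<in>\<E>. \<not> clique_minor E r t" "\<And>E. E \<in> \<E> \<Longrightarrow> symp E"
  shows "\<exists>s. \<forall>m. \<exists>N. \<forall>E\<in>\<E>. \<forall>A. finite A \<longrightarrow> N \<le> card A \<longrightarrow>
    (\<exists>S B. finite S \<and> card S \<le> s \<and> B \<subseteq> A \<and> card B = m \<and> scattered E S r B)"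
proof (induction r)
  case 0
  have "\<exists>S B. finite S \<and> card S \<le> 0 \<and> B \<subseteq> A \<and> card B = m \<and> scattered E S 0 B"
    if A: "finite A" "m \<le> card A" for E and A :: "'a set" and m
  proof -
    obtain B where "B \<subseteq> A" "card B = m"
      using obtain_subset_with_card_n[OF A(2)] by metis
    then show ?thesis
      by (intro exI[of _ "{}"] exI[of _ B]) (auto simp: scattered_def)
  qed
  then show ?case by blast
next
  case (Suc r)
  obtain t where t: "\<forall>E\<in>\<E>. \<not> clique_minor E (Suc r) t"
    using assms(1) by blast
  obtain s where s: "\<And>m. \<exists>N. \<forall>E\<in>\<E>. \<forall>A. finite A \<longrightarrow> N \<le> card A \<longrightarrow>
    (\<exists>S B. finite S \<and> card S \<le> s \<and> B \<subseteq> A \<and> card B = m \<and> scattered E S r B)"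
    using Suc by blast
  have "\<exists>N. \<forall>E\<in>\<E>. \<forall>A. finite A \<longrightarrow> N \<le> card A \<longrightarrow>
    (\<exists>S B. finite S \<and> card S \<le> s + t \<and> B \<subseteq> A \<and> card B = m \<and> scattered E S (Suc r) B)" for m
  proof -
    obtain N1 where N1: "\<And>(E :: 'a \<Rightarrow> 'a \<Rightarrow> bool) S A T. symp E \<Longrightarrow> finite A \<Longrightarrow> N1 \<le> card A \<Longrightarrow> scattered E S r A \<Longrightarrow>
     finite S \<Longrightarrow> T \<subseteq> S \<Longrightarrow> t \<le> card T + t \<Longrightarrow> (\<forall>w\<in>T. \<forall>a\<in>A. \<exists>u\<in>reach E S r a. E u w) \<Longrightarrow>
     clique_minor E (Suc r) t \<or>
     (\<exists>S' B. finite S' \<and> card S' \<le> card S + t \<and> B \<subseteq> A \<and> card B = m \<and> scattered E S' (Suc r) B)"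
      using wideness_iteration[of r t t m] by blast
    obtain N where N: "\<forall>E\<in>\<E>. \<forall>A. finite A \<longrightarrow> N \<le> card A \<longrightarrow>
      (\<exists>S B. finite S \<and> card S \<le> s \<and> B \<subseteq> A \<and> card B = N1 \<and> scattered E S r B)"
      using s by blast
    have "\<exists>S B. finite S \<and> card S \<le> s + t \<and> B \<subseteq> A \<and> card B = m \<and> scattered E S (Suc r) B"
      if EA: "E \<in> \<E>" "finite A" "N \<le> card A" for E A
    proof -
      obtain S B where B: "finite S" "card S \<le> s" "B \<subseteq> A" "card B = N1" "scattered E S r B"
        using N EA by blast
      have "finite B" using B(3) EA(2) finite_subset by blast
      then obtain S' D where "finite S'" "card S' \<le> card S + t" "D \<subseteq> B" "card D = m"
          "scattered E S' (Suc r) D"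
        using N1[of E B S "{}"] assms(2)[OF EA(1)] B t EA(1) by auto
      then show ?thesis
        using B by (intro exI[of _ S'] exI[of _ D]) auto
    qed
    then show ?thesis by blast
  qed
  then show ?case by blast
qed

section \<open>Co-matchings of the relation "at distance at most d"\<close>

lemma card_le_if_fibres_small:
  assumes "finite B" "\<And>q. q \<in> p ` B \<Longrightarrow> card {x \<in> B. p x = q} \<le> k"
  shows "card B \<le> k * card (p ` B)"
proof -
  have "B = (\<Union>q\<in>p ` B. {x \<in> B. p x = q})" by auto
  then have "card B \<le> (\<Sum>q\<in>p ` B. card {x \<in> B. p x = q})"
    using card_UN_le[of "p ` B" "\<lambda>q. {x \<in> B. p x = q}"] assms(1) by simp
  also have "\<dots> \<le> (\<Sum>q\<in>p ` B. k)"
    using assms(2) by (rule sum_mono)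
  finally show ?thesis by (simp add: mult.commute)
qed

lemma distance_comatchings_bounded:
  fixes \<E> :: "('a \<Rightarrow> 'a \<Rightarrow> bool) set"
  assumes "\<And>r. \<exists>t. \<forall>E\<in>\<E>. \<not> clique_minor E r t" "\<And>E. E \<in> \<E> \<Longrightarrow> symp E"
  shows "\<exists>k::nat. \<forall>E\<in>\<E>. \<forall>a b. \<not> (\<forall>i<k. b i \<notin> reach E {} d (a i) \<and>
    (\<forall>j<k. i \<noteq> j \<longrightarrow> b i \<in> reach E {} d (a j)))"
proof -
  obtain s where s: "\<forall>m. \<exists>N. \<forall>E\<in>\<E>. \<forall>A. finite A \<longrightarrow> N \<le> card A \<longrightarrow>
    (\<exists>S B. finite S \<and> card S \<le> s \<and> B \<subseteq> A \<and> card B = m \<and> scattered E S d B)"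
    using uniformly_quasi_wide[OF assms, where r = d] by blast
  \<comment> \<open>At most \<open>2 ^ (s * (d + 1))\<close> profiles exist, being subsets of
    \<open>S \<times> {..d}\<close>; one vertex more than twice that number forces three vertices
    with the same profile.\<close>
  define m where "m = 2 * 2 ^ (s * (d + 1)) + (1 :: nat)"
  obtain N where N: "\<forall>E\<in>\<E>. \<forall>A. finite A \<longrightarrow> N \<le> card A \<longrightarrow>
    (\<exists>S B. finite S \<and> card S \<le> s \<and> B \<subseteq> A \<and> card B = m \<and> scattered E S d B)"
    using s by blast
  have *: False if "E \<in> \<E>"
    and ab: "\<And>i. i < N \<Longrightarrow> b i \<notin> reach E {} d (a i)"
      "\<And>i j. i < N \<Longrightarrow> j < N \<Longrightarrow> i \<noteq> j \<Longrightarrow> b i \<in> reach E {} d (a j)" for E a b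
  proof -
    \<comment> \<open>Equal values of \<open>a\<close> at distinct indices would put some
      \<open>b i\<close> both inside and outside the same ball.\<close>
    have inj: "inj_on a {..<N}"
      using ab by (intro inj_onI) (metis lessThan_iff)
    then obtain S B where B: "finite S" "card S \<le> s" "B \<subseteq> a ` {..<N}" "card B = m" "scattered E S d B"
      using N \<open>E \<in> \<E>\<close> card_image[OF inj] by (metis card_lessThan finite_imageI finite_lessThan order_refl)
    have "finite B"
      using B(3) finite_subset by blast
    \<comment> \<open>The profile encodes the distances from \<open>x\<close> to the vertices of
      \<open>S\<close>, cut off beyond \<open>d\<close>. These paths may pass through
      \<open>S\<close>.\<close>
    define p where "p x = {(w, q). w \<in> S \<and> q \<le> d \<and> w \<in> reach E {} q x}" for x
    have "p ` B \<subseteq> Pow (S \<times> {..d})"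
      by (auto simp: p_def)
    then have "card (p ` B) \<le> card (Pow (S \<times> {..d}))"
      using B(1) by (intro card_mono) auto
    also have "\<dots> = 2 ^ (card S * (d + 1))"
      using B(1) by (simp add: card_Pow card_cartesian_product)
    also have "\<dots> \<le> 2 ^ (s * (d + 1))"
      using B(2) by (intro power_increasing mult_right_mono) auto
    finally have "\<not> card B \<le> 2 * card (p ` B)"
      using B(4) by (simp add: m_def)
    then obtain q where "\<not> card {x \<in> B. p x = q} \<le> 2"
      using card_le_if_fibres_small[OF \<open>finite B\<close>, of p 2] by blast
    then have "3 \<le> card {x \<in> B. p x = q}" by simp
    then obtain C where "C \<subseteq> {x \<in> B. p x = q}" "card C = 3" "finite C"
      by (rule obtain_subset_with_card_n)
    then obtain x y z where xyz: "x \<in> B" "y \<in> B" "z \<in> B" "p y = p x" "p z = p x"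
        "x \<noteq> y" "x \<noteq> z" "y \<noteq> z"
      by (auto simp: card_3_iff)
    have "\<exists>i<N. v = a i" if "v \<in> B" for v
      using B(3) that by blast
    then obtain i j l where ijl: "i < N" "j < N" "l < N" "x = a i" "y = a j" "z = a l"
      using xyz(1-3) by metis
    have notin: "y \<notin> S" "z \<notin> S"
      using xyz B(5) by (auto simp: scattered_def)
    have direct: "b i \<in> reach E S d v" if v: "v \<notin> S" "p v = p x" "b i \<in> reach E {} d v" for v
    proof (rule ccontr)
      assume "b i \<notin> reach E S d v"
      then obtain w q where w: "w \<in> S" "q \<le> d" "w \<in> reach E {} q v" "b i \<in> reach E {} (d - q) w"
        using reach_through[OF v(3,1)] by blast
      then have "(w, q) \<in> p x"
        using v(2) by (auto simp: p_def)
      then have "w \<in> reach E {} q x"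
        by (simp add: p_def)
      then have "b i \<in> reach E {} (q + (d - q)) x"
        using w(4) by (rule reach_trans)
      then show False
        using ab(1)[OF ijl(1)] w(2) ijl(4) by simp
    qed
    have "b i \<in> reach E {} d y" "b i \<in> reach E {} d z"
      using ab(2) ijl xyz by auto
    then have "b i \<in> reach E S d y \<inter> reach E S d z"
      using direct notin xyz by auto
    then show False
      using B(5) xyz unfolding scattered_def by blast
  qed
  show ?thesis
  proof (intro exI[of _ N] ballI allI notI)
    fix E a b
    assume "E \<in> \<E>" "\<forall>i<N. b i \<notin> reach E {} d (a i) \<and> (\<forall>j<N. i \<noteq> j \<longrightarrow> b i \<in> reach E {} d (a j))"
    then show False
      using *[where E = E and a = a and b = b] by blast
  qed
qed

section \<open>Powers of nowhere dense classes\<close>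

abbreviation adjacent :: "'a pair_pre_digraph \<Rightarrow> 'a \<Rightarrow> 'a \<Rightarrow> bool" where
  "adjacent G u v \<equiv> (u, v) \<in> parcs G"

lemma (in pair_graph) symp_adjacent: "symp (adjacent G)"
  using arcs_symmetric by (auto intro: sympI)

lemma (in pair_graph) reach_iff_awalk:
  assumes "u \<in> pverts G"
  shows "v \<in> reach (adjacent G) {} d u \<longleftrightarrow> (\<exists>p. awalk u p v \<and> length p \<le> d)"
proof
  show "\<exists>p. awalk u p v \<and> length p \<le> d" if "v \<in> reach (adjacent G) {} d u"
    using that
  proof (induction d arbitrary: v)
    case 0
    then show ?case using assms by (intro exI[of _ "[]"]) (auto simp: awalk_Nil_iff)
  next
    case (Suc d)
    show ?case
    proof (cases "v \<in> reach (adjacent G) {} d u")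
      case True
      then show ?thesis using Suc.IH[of v] by (meson le_SucI)
    next
      case False
      then obtain w where w: "w \<in> reach (adjacent G) {} d u" "adjacent G w v"
        using Suc.prems by auto
      then obtain p where p: "awalk u p w" "length p \<le> d"
        using Suc.IH by blast
      have "awalk w [(w, v)] v"
        using w(2) by (auto simp: awalk_simps in_arcsD2)
      then have "awalk u (p @ [(w, v)]) v"
        by (rule awalk_appendI[OF p(1)])
      then show ?thesis
        using p(2) by (intro exI[of _ "p @ [(w, v)]"]) simp
    qed
  qed
next
  assume "\<exists>p. awalk u p v \<and> length p \<le> d"
  then obtain p where p: "awalk u p v" "length p \<le> d" by blast
  have "v \<in> reach (adjacent G) {} (length p) u"
    using p(1)
  proof (induction p arbitrary: v rule: rev_induct)
    case Nil
    then show ?case by (simp add: awalk_Nil_iff)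
  next
    case (snoc e p)
    obtain x y where e: "e = (x, y)" by (cases e)
    have "awalk u p x" "adjacent G x v"
      using snoc.prems unfolding e by (auto simp: awalk_simps)
    then show ?case
      using snoc.IH[of x] by auto
  qed
  then show "v \<in> reach (adjacent G) {} d u"
    using reach_mono_radius[OF p(2), of "adjacent G" "{}" u] by blast
qed

lemma (in pair_graph) gdist_le_iff:
  assumes "u \<in> pverts G"
  shows "gdist G u v \<le> ereal (real d) \<longleftrightarrow> v \<in> reach (adjacent G) {} d u"
proof -
  have cost: "awalk_cost (\<lambda>_. 1) p = real (length p)" for p
    by (induction p) auto
  have dist: "gdist G u v = (INF p\<in>{p. awalk u p v}. ereal (real (length p)))"
    unfolding gdist_def \<mu>_def cost ..
  show ?thesis
  proof
    assume le: "gdist G u v \<le> ereal (real d)"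
    show "v \<in> reach (adjacent G) {} d u"
    proof (rule ccontr)
      assume "v \<notin> reach (adjacent G) {} d u"
      \<comment> \<open>Walk lengths are integers, so the infimum cannot approach \<open>d\<close>
        from above; if there is no walk at all it is infinite.\<close>
      then have "ereal (real (Suc d)) \<le> gdist G u v"
        unfolding reach_iff_awalk[OF assms] dist
        by (intro INF_greatest) (auto simp: not_le Suc_le_eq[symmetric])
      then have "ereal (real (Suc d)) \<le> ereal (real d)"
        using le by (rule order_trans)
      then show False by simp
    qed
  next
    assume "v \<in> reach (adjacent G) {} d u"
    then obtain p where "awalk u p v" "length p \<le> d"
      unfolding reach_iff_awalk[OF assms] by blast
    then show "gdist G u v \<le> ereal (real d)"
      unfolding dist by (intro INF_lower2[of p]) auto
  qed
qed

section \<open>From branch sets to depth-r minors\<close>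

definition induced_on :: "'a pair_pre_digraph \<Rightarrow> 'a set \<Rightarrow> 'a pair_pre_digraph" where
  "induced_on G X = \<lparr>pverts = X, parcs = {(u, v) \<in> parcs G. u \<in> X \<and> v \<in> X}\<rparr>"

lemma induced_on_simps [simp]:
  "pverts (induced_on G X) = X"
  "(u, v) \<in> parcs (induced_on G X) \<longleftrightarrow> (u, v) \<in> parcs G \<and> u \<in> X \<and> v \<in> X"
  by (auto simp: induced_on_def)

lemma (in pair_graph) pair_graph_induced_on:
  assumes "X \<subseteq> pverts G"
  shows "pair_graph (induced_on G X)"
proof
  have "parcs (induced_on G X) \<subseteq> parcs G"
    by (auto simp: induced_on_def)
  then show "finite (parcs (induced_on G X))"
    using finite_subset pair_finite_arcs by blast
  show "finite (pverts (induced_on G X))"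
    using finite_subset[OF assms pair_finite_verts] by simp
  show "symmetric (with_proj (induced_on G X))"
    using arcs_symmetric by (auto simp: symmetric_def intro!: symI)
  show "fst e \<noteq> snd e" if "e \<in> parcs (induced_on G X)" for e
    using that no_loops' by (cases e) auto
qed (auto simp: induced_on_def)

lemma reach_induced_on:
  "c \<in> X \<Longrightarrow> reach (adjacent (induced_on G X)) {} r c = reach (adjacent G) (- X) r c"
proof (induction r)
  case (Suc r)
  then show ?case
    using reach_avoids[of _ "adjacent G" "- X" r c] by auto
qed auto

text \<open>Turns a centred branch set of \<open>clique_minor\<close> into a connected subgraph of
  bounded radius as demanded by \<open>depth_minors\<close>. Two vertices are joined through the
  centre.\<close>

lemma (in pair_graph) centred_induced_on:
  assumes X: "X \<subseteq> pverts G" "c \<in> X" "X \<subseteq> reach (adjacent G) (- X) r c"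
  shows "radius (induced_on G X) \<le> ereal (real r)"
    and "Digraph_Component.connected (with_proj (induced_on G X))"
proof -
  interpret I: pair_graph "induced_on G X"
    by (rule pair_graph_induced_on[OF X(1)])
  have in_reach: "v \<in> reach (adjacent (induced_on G X)) {} r c" if "v \<in> X" for v
    using that X(3) reach_induced_on[OF X(2)] by blast
  have "(SUP v\<in>X. gdist (induced_on G X) c v) \<le> ereal (real r)"
    using in_reach I.gdist_le_iff X(2) by (intro SUP_least) simp
  then show "radius (induced_on G X) \<le> ereal (real r)"
    unfolding radius_def using X(2) by (intro INF_lower2[of c]) simp_all
  have from_c: "c \<rightarrow>\<^sup>*\<^bsub>with_proj (induced_on G X)\<^esub> v" if "v \<in> X" for v
    using in_reach[OF that] I.reach_iff_awalk[of c v r] X(2) I.reachable_awalk by auto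
  have "u \<rightarrow>\<^sup>*\<^bsub>with_proj (induced_on G X)\<^esub> v" if "u \<in> X" "v \<in> X" for u v
    using symmetric_reachable[OF I.pair_sym_arcs from_c[OF that(1)]] from_c[OF that(2)]
    by (rule I.reachable_trans)
  then have "strongly_connected (mk_symmetric (with_proj (induced_on G X)))"
    using X(2) by (intro strongly_connectedI I.reachable_mk_symmetricI) auto
  then show "Digraph_Component.connected (with_proj (induced_on G X))"
    by (simp add: Digraph_Component.connected_def)
qed

lemma (in pair_graph) reach_in_verts:
  "v \<in> reach (adjacent G) S r c \<Longrightarrow> v = c \<or> v \<in> pverts G \<and> c \<in> pverts G"
proof (induction r arbitrary: v)
  case (Suc r)
  show ?case
  proof (cases "v \<in> reach (adjacent G) S r c")
    case False
    then obtain u where u: "u \<in> reach (adjacent G) S r c" "adjacent G u v"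
      using Suc.prems by auto
    then show ?thesis
      using Suc.IH[OF u(1)] in_arcsD1[OF u(2)] in_arcsD2[OF u(2)] by auto
  qed (use Suc.IH in blast)
qed auto

lemma (in pair_graph) card_le_clique_number_contract:
  assumes "finite \<B>" "Defs.clique (contract G \<B>) K"
  shows "card K \<le> clique_number (contract G \<B>)"
proof -
  have "finite (pverts (contract G \<B>))"
    using assms(1) pair_finite_verts by (simp add: contract_def Let_def)
  then have "finite {K. Defs.clique (contract G \<B>) K}"
    by (intro finite_subset[of "{K. Defs.clique (contract G \<B>) K}" "Pow (pverts (contract G \<B>))"])
      (auto simp: Defs.clique_def)
  then show ?thesis
    unfolding clique_number_def using assms(2) by (intro cSup_upper bdd_above_finite) auto
qed

text \<open>\<open>clique_minor\<close> does not confine branch sets to the vertices of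
  \<open>G\<close>. With at least two of them, each contains an end of an edge, and its connection
  to the centre places the whole set in \<open>G\<close>.\<close>

lemma (in pair_graph) clique_minor_le:
  assumes "clique_minor (adjacent G) r t" "2 \<le> t"
    and k: "\<forall>M\<in>depth_minors r G. clique_number M \<le> k"
  shows "t \<le> k"
proof -
  obtain X c where Xc: "\<forall>i<t. c i \<in> X i \<and> X i \<subseteq> reach (adjacent G) (- X i) r (c i) \<and>
     (\<forall>j<t. i \<noteq> j \<longrightarrow> X i \<inter> X j = {} \<and> (\<exists>x\<in>X i. \<exists>y\<in>X j. adjacent G x y))"
    using assms(1) unfolding clique_minor_def by (elim exE)
  have X: "c i \<in> X i" "X i \<subseteq> reach (adjacent G) (- X i) r (c i)" if "i < t" for i
    using Xc that by simp_all
  have disj: "X i \<inter> X j = {}" if "i < t" "j < t" "i \<noteq> j" for i j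
    using Xc that by simp
  have adj: "\<exists>x\<in>X i. \<exists>y\<in>X j. adjacent G x y" if "i < t" "j < t" "i \<noteq> j" for i j
    using Xc that by simp
  have verts: "X i \<subseteq> pverts G" if "i < t" for i
  proof -
    define j where "j = (if i = 0 then 1 else 0 :: nat)"
    have "j < t" "i \<noteq> j" using \<open>2 \<le> t\<close> by (auto simp: j_def)
    then obtain x y where "x \<in> X i" "adjacent G x y"
      using adj[OF \<open>i < t\<close>] by blast
    then have "x \<in> X i" "x \<in> pverts G"
      using in_arcsD1 by blast+
    then have "c i \<in> pverts G"
      using reach_in_verts[of x "- X i" r "c i"] X(2)[OF that] by blast
    then show ?thesis
      using reach_in_verts[of _ "- X i" r "c i"] X(2)[OF that] by blast
  qed
  define \<B> where "\<B> = (\<lambda>i. induced_on G (X i)) ` {..<t}"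
  have "contract G \<B> \<in> depth_minors r G"
    unfolding depth_minors_def
  proof (intro CollectI exI conjI ballI impI)
    show "pair_graph G" ..
    show "subgraph (with_proj G) (with_proj G)"
      unfolding subgraph_def using wf_digraph by auto
    fix B assume "B \<in> \<B>"
    then obtain i where i: "i < t" "B = induced_on G (X i)"
      by (auto simp: \<B>_def)
    show "pair_graph B"
      unfolding i(2) by (rule pair_graph_induced_on[OF verts[OF i(1)]])
    then interpret B: pair_graph B .
    show "subgraph (with_proj B) (with_proj G)"
      unfolding subgraph_def using wf_digraph B.wf_digraph verts[OF i(1)] i(2) by auto
    show "Digraph_Component.connected (with_proj B)" "radius B \<le> ereal (real r)"
      unfolding i(2) using centred_induced_on[OF verts[OF i(1)] X[OF i(1)]] by blast+
    fix B' assume "B' \<in> \<B>" "B \<noteq> B'"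
    then obtain j where "j < t" "B' = induced_on G (X j)"
      by (auto simp: \<B>_def)
    then show "pverts B \<inter> pverts B' = {}"
      using disj[OF i(1)] i(2) \<open>B \<noteq> B'\<close> by auto
  qed simp
  then have "clique_number (contract G \<B>) \<le> k"
    using k by blast
  moreover have neq: "X i \<noteq> X j" if "i < t" "j < t" "i \<noteq> j" for i j
    using disj[OF that] X(1)[OF that(1)] by auto
  have "Defs.clique (contract G \<B>) (X ` {..<t})"
    unfolding Defs.clique_def
  proof (intro conjI ballI impI)
    show "X ` {..<t} \<noteq> {}"
      using \<open>2 \<le> t\<close> by (simp add: lessThan_empty_iff)
    have "pverts ` \<B> = X ` {..<t}"
      by (auto simp: \<B>_def image_image)
    then show *: "X ` {..<t} \<subseteq> pverts (contract G \<B>)"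
      by (simp add: contract_def Let_def)
    fix U W assume UW: "U \<in> X ` {..<t}" "W \<in> X ` {..<t}" "U \<noteq> W"
    then obtain i j where ij: "i < t" "j < t" "U = X i" "W = X j" "i \<noteq> j"
      by auto
    have "\<exists>x\<in>U. \<exists>y\<in>W. adjacent G x y"
      unfolding ij(3,4) by (rule adj[OF ij(1,2,5)])
    then show "adjacent (contract G \<B>) U W"
      using * UW by (auto simp: contract_def Let_def)
  qed
  then have "card (X ` {..<t}) \<le> clique_number (contract G \<B>)"
    by (intro card_le_clique_number_contract) (simp add: \<B>_def)
  moreover have "card (X ` {..<t}) = t"
    using card_image[of X "{..<t}"] neq by (metis card_lessThan inj_onI lessThan_iff)
  ultimately show ?thesis by simp
qed

section \<open>Induced subgraphs of powers\<close>

lemma reach_sym: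
  assumes "symp E"
  shows "v \<in> reach E {} d u \<Longrightarrow> u \<in> reach E {} d v"
proof (induction d arbitrary: v)
  case (Suc d)
  show ?case
  proof (cases "v \<in> reach E {} d u")
    case False
    then obtain w where w: "w \<in> reach E {} d u" "E w v"
      using Suc.prems by auto
    have "w \<in> reach E {} 1 v"
      using sympD[OF assms w(2)] by simp
    then have "u \<in> reach E {} (1 + d) v"
      using Suc.IH[OF w(1)] by (rule reach_trans)
    then show ?thesis by simp
  qed (use Suc.IH in simp)
qed simp

lemma induced_powerE:
  assumes "\<forall>G\<in>\<C>. pair_graph G" "H \<in> induced_closure (graph_power d ` \<C>)"
  obtains G where "G \<in> \<C>" "pverts H \<subseteq> pverts G" "\<And>u v. adjacent H u v \<longleftrightarrow>
    u \<in> pverts H \<and> v \<in> pverts H \<and> u \<noteq> v \<and> v \<in> reach (adjacent G) {} d u"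
proof -
  obtain G where G: "G \<in> \<C>" "induced_subgraph (with_proj H) (with_proj (graph_power d G))"
    using assms(2) by (auto simp: induced_closure_def)
  interpret pair_graph G using assms(1) G(1) by blast
  have verts: "pverts H \<subseteq> pverts G"
    using G(2) by (auto simp: induced_subgraph_def subgraph_def graph_power_def)
  have "parcs H = {(u, v). u \<in> pverts H \<and> v \<in> pverts H \<and> u \<noteq> v \<and> gdist G u v \<le> ereal (real d)}"
    using G(2) verts by (auto simp: induced_subgraph_def graph_power_def)
  then have "adjacent H u v \<longleftrightarrow>
      u \<in> pverts H \<and> v \<in> pverts H \<and> u \<noteq> v \<and> v \<in> reach (adjacent G) {} d u" for u v
    using gdist_le_iff[of u v d] verts by auto
  then show thesis
    using that G(1) verts by blast
qed

lemma pair_graph_induced_power: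
  assumes "\<forall>G\<in>\<C>. pair_graph G" "H \<in> induced_closure (graph_power d ` \<C>)"
  shows "pair_graph H"
proof -
  obtain G where G: "G \<in> \<C>" "pverts H \<subseteq> pverts G" "\<And>u v. adjacent H u v \<longleftrightarrow>
      u \<in> pverts H \<and> v \<in> pverts H \<and> u \<noteq> v \<and> v \<in> reach (adjacent G) {} d u"
    using induced_powerE[OF assms] by metis
  interpret G: pair_graph G using assms(1) G(1) by blast
  have fin: "finite (pverts H)"
    using G(2) G.pair_finite_verts finite_subset by blast
  show ?thesis
  proof
    show "finite (parcs H)"
      by (rule finite_subset[of _ "pverts H \<times> pverts H"]) (use fin G(3) in auto)
    show "symmetric (with_proj H)"
      unfolding symmetric_def using G(3) reach_sym[OF G.symp_adjacent] by (auto intro!: symI)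
    show "fst e \<in> pverts H" "snd e \<in> pverts H" "fst e \<noteq> snd e" if "e \<in> parcs H" for e
      using that G(3) by (cases e; simp)+
  qed (rule fin)
qed

lemma power_comatchings_bounded:
  fixes \<C> :: "'a pair_pre_digraph set"
  assumes C: "\<forall>G\<in>\<C>. pair_graph G" and "nowhere_dense \<C>"
  shows "\<exists>k. \<forall>H\<in>induced_closure (graph_power d ` \<C>). \<not> comatching_on (adjacent H) k (pverts H)"
proof -
  have "\<exists>t. \<forall>E\<in>adjacent ` \<C>. \<not> clique_minor E r t" for r
  proof -
    obtain k where "\<forall>G\<in>\<C>. \<forall>M\<in>depth_minors r G. clique_number M \<le> k"
      using assms(2) unfolding nowhere_dense_def by blast
    \<comment> \<open>\<open>k + 2\<close> exceeds the clique bound and guarantees two branch sets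
      even for \<open>k = 0\<close>.\<close>
    then have "\<not> clique_minor (adjacent G) r (k + 2)" if "G \<in> \<C>" for G
      using pair_graph.clique_minor_le[of G r "k + 2" k] C that by fastforce
    then show ?thesis by blast
  qed
  moreover have "symp E" if "E \<in> adjacent ` \<C>" for E
    using that C pair_graph.symp_adjacent by blast
  ultimately obtain k :: nat where k: "\<forall>E\<in>adjacent ` \<C>. \<forall>a b. \<not> (\<forall>i<k. b i \<notin> reach E {} d (a i) \<and>
    (\<forall>j<k. i \<noteq> j \<longrightarrow> b i \<in> reach E {} d (a j)))"
    using distance_comatchings_bounded[of "adjacent ` \<C>" d] by blast
  have "\<not> comatching_on (adjacent H) k (pverts H)" if H: "H \<in> induced_closure (graph_power d ` \<C>)" for H
  proof
    assume com: "comatching_on (adjacent H) k (pverts H)"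
    obtain G where G: "G \<in> \<C>" "pverts H \<subseteq> pverts G" "\<And>u v. adjacent H u v \<longleftrightarrow>
        u \<in> pverts H \<and> v \<in> pverts H \<and> u \<noteq> v \<and> v \<in> reach (adjacent G) {} d u"
      using induced_powerE[OF C H] by metis
    interpret H: pair_graph H by (rule pair_graph_induced_power[OF C H])
    obtain a b where ab: "\<forall>i<k. a i \<in> pverts H \<and> b i \<in> pverts H \<and> a i \<noteq> b i \<and>
        \<not> adjacent H (a i) (b i) \<and> (\<forall>j<k. i \<noteq> j \<longrightarrow> adjacent H (a i) (b j))"
      using comatching_onD[OF H.symp_adjacent com] by (elim exE)
    \<comment> \<open>Here \<open>a i \<noteq> b i\<close> matters: a vertex is not adjacent to
      itself in \<open>H\<close> although its distance to itself is 0.\<close>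
    have "b i \<notin> reach (adjacent G) {} d (a i)" if "i < k" for i
      using ab G(3)[of "a i" "b i"] that by blast
    moreover have "b i \<in> reach (adjacent G) {} d (a j)" if "i < k" "j < k" "i \<noteq> j" for i j
      using ab G(3)[of "a j" "b i"] that by metis
    moreover have "\<not> (\<forall>i<k. b i \<notin> reach (adjacent G) {} d (a i) \<and>
        (\<forall>j<k. i \<noteq> j \<longrightarrow> b i \<in> reach (adjacent G) {} d (a j)))"
      using k G(1) by simp
    ultimately show False by blast
  qed
  then show ?thesis by blast
qed

section \<open>Running programs\<close>

definition runs :: "prog \<Rightarrow> store \<Rightarrow> nat \<Rightarrow> (store \<Rightarrow> bool) \<Rightarrow> bool" where
  "runs c s T Q \<longleftrightarrow> (\<exists>t s'. exec c s t s' \<and> t \<le> T \<and> Q s')"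

text \<open>Framing tracks whole memories rather than cells, which is why every scalar variable has
  a memory of its own.\<close>

primrec writes :: "prog \<Rightarrow> nat set" where
  "writes Skip = {}"
| "writes (Write m e f) = {m}"
| "writes (Seq c c') = writes c \<union> writes c'"
| "writes (If e c c') = writes c \<union> writes c'"
| "writes (While e c) = writes c"

lemma exec_frame: "exec c s t s' \<Longrightarrow> m \<notin> writes c \<Longrightarrow> s' m = s m"
  by (induction rule: exec.induct) auto

lemma runs_conseq:
  assumes "runs c s T Q" "T \<le> T'"
    and "\<And>s'. Q s' \<Longrightarrow> (\<And>m. m \<notin> writes c \<Longrightarrow> s' m = s m) \<Longrightarrow> Q' s'"
  shows "runs c s T' Q'"
  using assms exec_frame unfolding runs_def by (metis order_trans)

lemma runs_Write:
  "Q (s(m := (s m)(val e s := val f s))) \<Longrightarrow> runs (Write m e f) s 1 Q"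
  unfolding runs_def using exec.Write by blast

lemma runs_Seq: "runs c s T (\<lambda>s'. runs c' s' T' Q) \<Longrightarrow> runs (Seq c c') s (T + T') Q"
  unfolding runs_def by (meson add_mono exec.Seq)

lemma runs_Seq':
  assumes "runs c s T R"
    and "\<And>s'. R s' \<Longrightarrow> (\<And>m. m \<notin> writes c \<Longrightarrow> s' m = s m) \<Longrightarrow> runs c' s' T' Q"
  shows "runs (Seq c c') s (T + T') Q"
  by (rule runs_Seq, rule runs_conseq[OF assms(1) order_refl assms(2)])

abbreviation var :: "nat \<Rightarrow> exp" where
  "var x \<equiv> Read x (Const 0)"

abbreviation assign :: "nat \<Rightarrow> exp \<Rightarrow> prog" where
  "assign x e \<equiv> Write x (Const 0) e"

text \<open>Truncated subtraction makes \<open>Sub e (var x)\<close> non-zero exactly while the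
  counter is below \<open>e\<close>.\<close>

definition for_loop :: "nat \<Rightarrow> exp \<Rightarrow> prog \<Rightarrow> prog" where
  "for_loop x e c =
     Seq (assign x (Const 0)) (While (Sub e (var x)) (Seq c (assign x (Add (var x) (Const 1)))))"

lemma writes_for_loop [simp]: "writes (for_loop x e c) = insert x (writes c)"
  by (auto simp: for_loop_def)

text \<open>One step initialises the counter; each iteration adds a test and an increment to the
  body; the last step is the failing test. Only sums, products and 1 occur, so the term can also be
  read as a polynomial.\<close>

definition for_time :: "'b::comm_semiring_1 \<Rightarrow> 'b \<Rightarrow> 'b" where
  "for_time n t = 1 + (n * (t + (1 + 1)) + 1)"

text \<open>Memories that the body does not write keep their contents, so \<open>I\<close> has to
  describe only what changes. \<open>bound\<close> makes the limit invariant, \<open>indep\<close>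
  lets the counter advance outside \<open>I\<close>, and \<open>B\<close> rounds the number of
  iterations up to a common size parameter.\<close>

lemma runs_for_loop:
  assumes init: "I 0 (s(x := (s x)(0 := 0)))"
    and step: "\<And>i s'. i < N \<Longrightarrow> I i s' \<Longrightarrow> s' x 0 = i \<Longrightarrow>
      (\<And>m. m \<noteq> x \<Longrightarrow> m \<notin> writes c \<Longrightarrow> s' m = s m) \<Longrightarrow> runs c s' T (I (Suc i))"
    and x: "x \<notin> writes c"
    and bound: "\<And>s'. (\<And>m. m \<noteq> x \<Longrightarrow> m \<notin> writes c \<Longrightarrow> s' m = s m) \<Longrightarrow> val e s' = N"
    and indep: "\<And>i s' k. I i s' \<Longrightarrow> I i (s'(x := (s' x)(0 := k)))"
    and B: "N \<le> B"
  shows "runs (for_loop x e c) s (for_time B T) (I N)"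
proof -
  let ?w = "While (Sub e (var x)) (Seq c (assign x (Add (var x) (Const 1))))"
  have loop: "runs ?w s' ((N - i) * (T + 2) + 1) (I N)"
    if "i \<le> N" "I i s'" "s' x 0 = i" "\<And>m. m \<noteq> x \<Longrightarrow> m \<notin> writes c \<Longrightarrow> s' m = s m" for i s'
    using that
  proof (induction "N - i" arbitrary: i s')
    case 0
    have "exec ?w s' 1 s'"
      by (rule WhileFalse) (use 0 bound[OF 0(5)] in simp)
    then show ?case
      using 0 by (auto simp: runs_def)
  next
    case (Suc d)
    have "i < N" using Suc.hyps(2) by simp
    obtain t s1 where s1: "exec c s' t s1" "t \<le> T" "I (Suc i) s1"
      using step[OF \<open>i < N\<close> Suc.prems(2-4)] by (auto simp: runs_def)
    have frame: "s1 m = s' m" if "m \<notin> writes c" for m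
      using exec_frame[OF s1(1) that] .
    define s2 where "s2 = s1(x := (s1 x)(0 := Suc i))"
    have "exec (assign x (Add (var x) (Const 1))) s1 1 s2"
      using exec.Write[of x "Const 0" "Add (var x) (Const 1)" s1] frame[OF x] Suc.prems(3)
      by (simp add: s2_def)
    then have body: "exec (Seq c (assign x (Add (var x) (Const 1)))) s' (t + 1) s2"
      by (rule exec.Seq[OF s1(1)])
    have "runs ?w s2 ((N - Suc i) * (T + 2) + 1) (I N)"
    proof (rule Suc.hyps(1))
      show "I (Suc i) s2" using indep[OF s1(3)] by (simp add: s2_def)
      show "s2 m = s m" if "m \<noteq> x" "m \<notin> writes c" for m
        using that frame Suc.prems(4) by (simp add: s2_def)
    qed (use Suc.hyps(2) \<open>i < N\<close> in \<open>auto simp: s2_def\<close>)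
    then obtain t' s3 where s3: "exec ?w s2 t' s3" "t' \<le> (N - Suc i) * (T + 2) + 1" "I N s3"
      by (auto simp: runs_def)
    have "exec ?w s' (1 + (t + 1) + t') s3"
      by (rule WhileTrue[OF _ body s3(1)]) (use Suc.prems(3) bound[OF Suc.prems(4)] \<open>i < N\<close> in simp)
    moreover have "N - i = Suc (N - Suc i)" using \<open>i < N\<close> by simp
    then have "1 + (t + 1) + t' \<le> (N - i) * (T + 2) + 1"
      using s1(2) s3(2) by simp
    ultimately show ?case
      using s3(3) unfolding runs_def by blast
  qed
  have "runs ?w (s(x := (s x)(0 := 0))) ((N - 0) * (T + 2) + 1) (I N)"
    by (rule loop) (use init in auto)
  moreover have "(N - 0) * (T + 2) + 1 \<le> B * (T + 2) + 1"
    unfolding diff_zero by (intro add_right_mono mult_right_mono B) simp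
  ultimately have "runs ?w (s(x := (s x)(0 := 0))) (B * (T + 2) + 1) (I N)"
    by (rule runs_conseq)
  then have "runs (for_loop x e c) s (1 + (B * (T + 2) + 1)) (I N)"
    unfolding for_loop_def by (intro runs_Seq runs_Write) simp
  then show ?thesis
    by (simp add: for_time_def)
qed

section \<open>The enumeration program\<close>

lemma runs_assign:
  "runs (Write m e f) s 1 (\<lambda>s'. s' = s(m := (s m)(val e s := val f s)))"
  by (rule runs_Write) simp

text \<open>
  The scalar variables are memory 3 (the vertex added in the current round), 4 and 5 (the positions at
  which the maximal cliques of the previous and of the current round start), 6 (number of items), 7
  (loop counter over the items of the previous round), 8 (the result of the tests), 9 and 10
  (addresses of the candidate and of the clique it is made from), 11 to 17 (counters and scratch), and
  18, 19 (output). Memory 2 is a queue of cliques, each stored as a characteristic vector; those of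
  earlier rounds are never removed. A candidate is written behind the end of the queue and becomes
  part of it when the number of items is increased.
\<close>

abbreviation order_var :: exp where
  "order_var \<equiv> Read 0 (Const 0)"

text \<open>Addresses in the matrix and in the queue are multiples of the number of vertices; they
  are obtained by repeated addition, with memory 17 reserved as the counter.\<close>

definition mul :: "nat \<Rightarrow> exp \<Rightarrow> prog" where
  "mul z e = Seq (assign z (Const 0)) (for_loop 17 e (assign z (Add (var z) order_var)))"

lemma writes_mul [simp]: "writes (mul z e) = {z, 17}"
  by (auto simp: mul_def)

definition mul_time :: "'b::comm_semiring_1 \<Rightarrow> 'b" where
  "mul_time B = 1 + for_time B 1"

lemma runs_mul:
  assumes "z \<noteq> 0" "z \<noteq> 17" "k \<le> B"
    and "\<And>s'. (\<And>m. m \<noteq> z \<Longrightarrow> m \<noteq> 17 \<Longrightarrow> s' m = s m) \<Longrightarrow> val e s' = k"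
  shows "runs (mul z e) s (mul_time B) (\<lambda>s'. s' z 0 = k * s 0 0)"
  unfolding mul_def mul_time_def
proof (rule runs_Seq'[OF runs_assign])
  fix s1 assume s1: "s1 = s(z := (s z)(val (Const 0) s := val (Const 0) s))"
  show "runs (for_loop 17 e (assign z (Add (var z) order_var))) s1 (for_time B 1)
      (\<lambda>s'. s' z 0 = k * s 0 0)"
  proof (rule runs_for_loop[where I = "\<lambda>i s'. s' z 0 = i * s 0 0"])
    fix i s' assume *: "i < k" "s' z 0 = i * s 0 0"
      and frame: "\<And>m. m \<noteq> 17 \<Longrightarrow> m \<notin> writes (assign z (Add (var z) order_var)) \<Longrightarrow> s' m = s1 m"
    have "s' 0 = s 0"
      using frame[of 0] assms(1) by (simp add: s1)
    then show "runs (assign z (Add (var z) order_var)) s' 1 (\<lambda>s'. s' z 0 = Suc i * s 0 0)"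
      using * by (intro runs_Write) simp
  next
    fix s' assume "\<And>m. m \<noteq> 17 \<Longrightarrow> m \<notin> writes (assign z (Add (var z) order_var)) \<Longrightarrow> s' m = s1 m"
    then show "val e s' = k"
      using assms(4)[of s'] by (simp add: s1)
  qed (use assms s1 in auto)
qed

section \<open>Characteristic vectors: copying and restricting\<close>

definition row :: "(nat \<Rightarrow> nat) \<Rightarrow> nat \<Rightarrow> nat \<Rightarrow> nat set \<Rightarrow> bool" where
  "row f b n K \<longleftrightarrow> (\<forall>j<n. f (b + j) = of_bool (j \<in> K))"

lemma rowD: "row f b n K \<Longrightarrow> j < n \<Longrightarrow> f (b + j) = of_bool (j \<in> K)"
  by (simp add: row_def)

lemma row_0 [simp]: "row f b 0 K"
  by (simp add: row_def)

lemma row_Suc_upd: "row f b i K \<Longrightarrow> v = of_bool (i \<in> K) \<Longrightarrow> row (f(b + i := v)) b (Suc i) K"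
  by (auto simp: row_def less_Suc_eq)

definition matrix :: "(nat \<Rightarrow> nat) \<Rightarrow> nat \<Rightarrow> (nat \<Rightarrow> nat \<Rightarrow> bool) \<Rightarrow> bool" where
  "matrix f n E \<longleftrightarrow> f 0 = n \<and> (\<forall>i<n. \<forall>j<n. f (Suc (i * n + j)) = of_bool (E i j))"

definition copy_row :: prog where
  "copy_row = for_loop 11 order_var
     (Write 2 (Add (var 9) (var 11)) (Read 2 (Add (var 10) (var 11))))"

lemma writes_copy_row [simp]: "writes copy_row = {2, 11}"
  by (auto simp: copy_row_def)

lemma runs_copy_row:
  assumes "s 0 0 = n" "s 9 0 = b" "s 10 0 = b'" "b' + n \<le> b" "row (s 2) b' n K" "n \<le> B"
  shows "runs copy_row s (for_time B 1) (\<lambda>s'. row (s' 2) b n K \<and> (\<forall>p<b. s' 2 p = s 2 p))"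
  unfolding copy_row_def
proof (rule runs_for_loop[where I = "\<lambda>i s'. row (s' 2) b i K \<and> (\<forall>p<b. s' 2 p = s 2 p)"], goal_cases)
  case (2 i s')
  have "s' 9 0 = b" "s' 10 0 = b'"
    using 2(4)[of 9] 2(4)[of 10] assms by simp_all
  moreover have "s' 2 (b' + i) = of_bool (i \<in> K)"
    using rowD[OF assms(5), of i] 2(1,2) assms(4) by simp
  ultimately show ?case
    using 2(2,3) by (intro runs_Write) (simp add: row_Suc_upd)
qed (use assms in auto)

text \<open>For bits, truncated \<open>a + b - 1\<close> is conjunction; here it intersects the
  clique with the adjacency row of the new vertex, whose own bit is then set separately.\<close>

definition restrict_row :: prog where
  "restrict_row = Seq (mul 13 (var 3)) (Seq
     (for_loop 11 order_var (Write 2 (Add (var 9) (var 11))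
       (Sub (Add (Read 2 (Add (var 10) (var 11))) (Read 0 (Add (Const 1) (Add (var 13) (var 11))))) (Const 1))))
     (Write 2 (Add (var 9) (var 3)) (Const 1)))"

definition restrict_time :: "'b::comm_semiring_1 \<Rightarrow> 'b" where
  "restrict_time B = mul_time B + (for_time B 1 + 1)"

lemma writes_restrict_row [simp]: "writes restrict_row = {2, 11, 13, 17}"
  by (auto simp: restrict_row_def)

lemma runs_restrict_row:
  assumes "matrix (s 0) n E" "s 3 0 = i" "i < n" "s 9 0 = b" "s 10 0 = b'" "b' + n \<le> b"
    and "row (s 2) b' n K" "n \<le> B"
  shows "runs restrict_row s (restrict_time B)
    (\<lambda>s'. row (s' 2) b n (insert i {x \<in> K. E i x}) \<and> (\<forall>p<b. s' 2 p = s 2 p))"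
  unfolding restrict_row_def restrict_time_def
proof (rule runs_Seq'[OF runs_mul[where k = i]], goal_cases)
  case (5 s1)
  let ?N = "{x \<in> K. E i x}"
  have s1: "s1 13 0 = i * n" "s1 0 = s 0" "s1 3 = s 3" "s1 9 = s 9" "s1 10 = s 10" "s1 2 = s 2"
    using 5(1) 5(2)[of 0] 5(2)[of 3] 5(2)[of 9] 5(2)[of 10] 5(2)[of 2] assms(1)
    by (simp_all add: matrix_def)
  show ?case
  proof (rule runs_Seq'[OF runs_for_loop[where N = n and B = B and T = 1
        and I = "\<lambda>j s'. row (s' 2) b j ?N \<and> (\<forall>p<b. s' 2 p = s 2 p)"]], goal_cases)
    case (2 j s')
    have s': "s' 9 0 = b" "s' 10 0 = b'" "s' 13 0 = i * n" "s' 0 = s 0"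
      using 2(4)[of 9] 2(4)[of 10] 2(4)[of 13] 2(4)[of 0] assms s1 by simp_all
    have "s' 2 (b' + j) = of_bool (j \<in> K)"
      using rowD[OF assms(7), of j] 2(1,2) assms(6) by simp
    moreover have "s 0 (Suc (i * n + j)) = of_bool (E i j)"
      using assms(1,3) 2(1) by (simp add: matrix_def)
    ultimately show ?case
      using 2(2,3) s' by (intro runs_Write) (simp add: row_Suc_upd)
  next
    case (7 s')
    have "s' 9 0 = b" "s' 3 0 = i"
      using 7(2)[of 9] 7(2)[of 3] s1 assms by simp_all
    then show ?case
      using 7(1) by (intro runs_Write) (auto simp: row_def)
  qed (use assms s1 in \<open>auto simp: matrix_def\<close>)
qed (use assms in auto)

section \<open>Testing a candidate for maximality and novelty\<close>

lemma of_bool_diff_nat: "of_bool P - of_bool Q = (of_bool (P \<and> \<not> Q) :: nat)"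
  by auto

text \<open>Memory 16 flags a vertex outside the candidate that sees all of it, and each such vertex
  clears the result in memory 8. The limit includes the new vertex but no later one, since
  maximality is meant in the current prefix.\<close>

definition maximal_test :: prog where
  "maximal_test = Seq (assign 8 (Const 1)) (for_loop 12 (Add (var 3) (Const 1))
     (Seq (mul 13 (var 12)) (Seq (assign 16 (Sub (Const 1) (Read 2 (Add (var 9) (var 12)))))
     (Seq (for_loop 11 order_var (assign 16 (Sub (var 16) (Sub (Read 2 (Add (var 9) (var 11)))
         (Read 0 (Add (Const 1) (Add (var 13) (var 11))))))))
       (assign 8 (Sub (var 8) (var 16)))))))"

definition test_time :: "'b::comm_semiring_1 \<Rightarrow> 'b" where
  "test_time B = for_time B (mul_time B + (1 + (for_time B 1 + 1)))"

lemma writes_maximal_test [simp]: "writes maximal_test = {8, 11, 12, 13, 16, 17}"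
  by (auto simp: maximal_test_def)

lemma runs_maximal_test:
  assumes "matrix (s 0) n E" "s 3 0 = i" "i < n" "s 9 0 = b" "row (s 2) b n C" "C \<subseteq> {..<n}" "n \<le> B"
  shows "runs maximal_test s (1 + test_time B)
    (\<lambda>s'. s' 8 0 = of_bool (\<forall>x\<in>{..<Suc i} - C. \<exists>y\<in>C. \<not> E x y))"
  unfolding maximal_test_def test_time_def
proof (rule runs_Seq'[OF runs_assign], goal_cases)
  case (1 s1)
  \<comment> \<open>The flag in memory 16 after \<open>m\<close> iterations of the inner loop, when
    only members of \<open>C\<close> below \<open>m\<close> have been inspected.\<close>
  define D where "D m x \<longleftrightarrow> x \<notin> C \<and> (\<forall>y\<in>C. y < m \<longrightarrow> E x y)" for m x
  have s1: "s1 0 = s 0" "s1 3 = s 3" "s1 9 = s 9" "s1 2 = s 2" "s1 8 0 = 1"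
    using 1(1) by simp_all
  let ?I = "\<lambda>k s'. s' 8 0 = of_bool (\<forall>x<k. \<not> D n x)"
  have "runs (for_loop 12 (Add (var 3) (Const 1))
     (Seq (mul 13 (var 12)) (Seq (assign 16 (Sub (Const 1) (Read 2 (Add (var 9) (var 12)))))
     (Seq (for_loop 11 order_var (assign 16 (Sub (var 16) (Sub (Read 2 (Add (var 9) (var 11)))
         (Read 0 (Add (Const 1) (Add (var 13) (var 11))))))))
       (assign 8 (Sub (var 8) (var 16)))))))
     s1 (for_time B (mul_time B + (1 + (for_time B 1 + 1)))) (?I (Suc i))"
  proof (rule runs_for_loop[where N = "Suc i"], goal_cases)
    case (2 x s2)
    have "x < n" using 2(1) assms(3) by simp
    have s2: "s2 0 = s 0" "s2 9 = s 9" "s2 2 = s 2"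
      using 2(4)[of 0] 2(4)[of 9] 2(4)[of 2] s1 by simp_all
    show ?case
    proof (rule runs_Seq'[OF runs_mul[where k = x]], goal_cases)
      case (5 s3)
      have s3: "s3 0 = s 0" "s3 9 = s 9" "s3 2 = s 2" "s3 13 0 = x * n" "s3 12 0 = x" "s3 8 = s2 8"
        using 5(1) 5(2)[of 0] 5(2)[of 9] 5(2)[of 2] 5(2)[of 12] 5(2)[of 8] s2 2(3) assms(1)
        by (simp_all add: matrix_def)
      show ?case
      proof (rule runs_Seq'[OF runs_assign], goal_cases)
        case (1 s4)
        have s4: "s4 0 = s 0" "s4 9 = s 9" "s4 2 = s 2" "s4 13 0 = x * n" "s4 8 = s2 8"
            "s4 16 0 = of_bool (D 0 x)"
          using 1(1) s3 assms(4) rowD[OF assms(5) \<open>x < n\<close>] by (simp_all add: D_def)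
        show ?case
        proof (rule runs_Seq'[OF runs_for_loop[where N = n and B = B and T = 1
              and I = "\<lambda>m s'. s' 16 0 = of_bool (D m x)"]], goal_cases)
          case (2 j s5)
          have s5: "s5 0 = s 0" "s5 9 = s 9" "s5 2 = s 2" "s5 13 0 = x * n"
            using 2(4)[of 0] 2(4)[of 9] 2(4)[of 2] 2(4)[of 13] s4 by simp_all
          have "s 2 (b + j) = of_bool (j \<in> C)"
            using rowD[OF assms(5)] 2(1) by simp
          moreover have "s 0 (Suc (x * n + j)) = of_bool (E x j)"
            using assms(1) \<open>x < n\<close> 2(1) by (simp add: matrix_def)
          moreover have "D (Suc j) x \<longleftrightarrow> D j x \<and> \<not> (j \<in> C \<and> \<not> E x j)"
            by (auto simp: D_def less_Suc_eq)
          ultimately show ?case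
            using 2(2,3) s5 assms(4) by (intro runs_Write) (simp add: of_bool_diff_nat)
        next
          case (7 s5)
          have "s5 8 0 = of_bool (\<forall>x'<x. \<not> D n x')"
            using 7(2)[of 8] s4 2(2) by simp
          moreover have "(\<forall>x'<Suc x. \<not> D n x') \<longleftrightarrow> (\<forall>x'<x. \<not> D n x') \<and> \<not> D n x"
            by (auto simp: less_Suc_eq)
          ultimately show ?case
            using 7(1) by (intro runs_Write) (simp add: of_bool_diff_nat)
        qed (use assms s4 in \<open>auto simp: matrix_def\<close>)
      qed
    qed (use assms \<open>x < n\<close> 2 in auto)
  qed (use assms s1 in auto)
  moreover have "(\<forall>x<Suc i. \<not> D n x) \<longleftrightarrow> (\<forall>x\<in>{..<Suc i} - C. \<exists>y\<in>C. \<not> E x y)"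
    using assms(6) by (auto simp: D_def)
  ultimately show ?case by simp
qed

text \<open>The sum of the two truncated differences is 1 exactly where the vectors differ, so the
  flag survives only for equal vectors. Comparison starts at the current round: a clique may
  legitimately recur from an earlier round.\<close>

definition new_test :: prog where
  "new_test = for_loop 14 (Sub (var 6) (var 5))
     (Seq (mul 15 (Add (var 5) (var 14))) (Seq (assign 16 (Const 1))
     (Seq (for_loop 11 order_var (assign 16 (Sub (var 16)
         (Add (Sub (Read 2 (Add (var 9) (var 11))) (Read 2 (Add (var 15) (var 11))))
              (Sub (Read 2 (Add (var 15) (var 11))) (Read 2 (Add (var 9) (var 11))))))))
       (assign 8 (Sub (var 8) (var 16))))))"

lemma writes_new_test [simp]: "writes new_test = {8, 11, 14, 15, 16, 17}"
  by (auto simp: new_test_def)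

definition items :: "store \<Rightarrow> nat \<Rightarrow> nat set list \<Rightarrow> bool" where
  "items s n Ls \<longleftrightarrow> s 6 0 = length Ls \<and> (\<forall>c<length Ls. row (s 2) (c * n) n (Ls ! c))"

lemma items_cong:
  "items s n Ls \<Longrightarrow> s' 2 = s 2 \<Longrightarrow> s' 6 0 = s 6 0 \<Longrightarrow> items s' n Ls"
  by (simp add: items_def)

lemma items_snoc:
  assumes "items s n Ls" "row (s 2) (length Ls * n) n C" "s' 2 = s 2" "s' 6 0 = s 6 0 + 1"
  shows "items s' n (Ls @ [C])"
proof -
  have "row (s 2) (c * n) n ((Ls @ [C]) ! c)" if "c < Suc (length Ls)" for c
    using assms(1,2) that by (cases "c = length Ls") (auto simp: items_def nth_append)
  then show ?thesis
    using assms by (simp add: items_def)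
qed

lemma runs_new_test:
  assumes "s 0 0 = n" "s 5 0 = length Old" "items s n (Old @ New)" "s 9 0 = b" "row (s 2) b n C"
    and "C \<subseteq> {..<n}" "\<And>K. K \<in> set New \<Longrightarrow> K \<subseteq> {..<n}" "s 8 0 = of_bool P"
    and "n \<le> B" "length (Old @ New) \<le> B"
  shows "runs new_test s (test_time B) (\<lambda>s'. s' 8 0 = of_bool (P \<and> C \<notin> set New))"
proof -
  let ?I = "\<lambda>k s'. s' 8 0 = of_bool (P \<and> C \<notin> set (take k New))"
  have "runs new_test s (test_time B) (?I (length New))"
    unfolding new_test_def test_time_def
  proof (rule runs_for_loop[where N = "length New"], goal_cases)
    case (2 e s2)
    define K where "K = New ! e"
    have K: "row (s 2) ((length Old + e) * n) n K" "K \<subseteq> {..<n}"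
      using assms(3,7) 2(1) by (auto simp: items_def K_def nth_append dest!: spec[of _ "length Old + e"])
    have s2: "s2 0 = s 0" "s2 9 = s 9" "s2 2 = s 2" "s2 5 = s 5"
      using 2(4)[of 0] 2(4)[of 9] 2(4)[of 2] 2(4)[of 5] by simp_all
    define D where "D m \<longleftrightarrow> (\<forall>j<m. j \<in> C \<longleftrightarrow> j \<in> K)" for m
    show ?case
    proof (rule runs_Seq'[OF runs_mul[where k = "length Old + e"]], goal_cases)
      case (4 s')
      show ?case
        using 4[of 5] 4[of 14] s2 2(3) assms(2) by simp
    next
      case (5 s3)
      have s3: "s3 0 = s 0" "s3 9 = s 9" "s3 2 = s 2" "s3 15 0 = (length Old + e) * n" "s3 8 = s2 8"
        using 5(1) 5(2)[of 0] 5(2)[of 9] 5(2)[of 2] 5(2)[of 8] s2 assms(1) by simp_all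
      show ?case
      proof (rule runs_Seq'[OF runs_assign], goal_cases)
        case (1 s4)
        have s4: "s4 0 = s 0" "s4 9 = s 9" "s4 2 = s 2" "s4 15 0 = (length Old + e) * n" "s4 8 = s2 8"
            "s4 16 0 = of_bool (D 0)"
          using 1(1) s3 by (simp_all add: D_def)
        show ?case
        proof (rule runs_Seq'[OF runs_for_loop[where N = n and B = B and T = 1
              and I = "\<lambda>m s'. s' 16 0 = of_bool (D m)"]], goal_cases)
          case (2 j s5)
          have s5: "s5 9 = s 9" "s5 2 = s 2" "s5 15 0 = (length Old + e) * n"
            using 2(4)[of 9] 2(4)[of 2] 2(4)[of 15] s4 by simp_all
          have "s 2 (b + j) = of_bool (j \<in> C)" "s 2 ((length Old + e) * n + j) = of_bool (j \<in> K)"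
            using rowD[OF assms(5)] rowD[OF K(1)] 2(1) by simp_all
          moreover have "D (Suc j) \<longleftrightarrow> D j \<and> (j \<in> C \<longleftrightarrow> j \<in> K)"
            by (auto simp: D_def less_Suc_eq)
          ultimately show ?case
            using 2(2,3) s5 assms(4) by (intro runs_Write) auto
        next
          case (7 s5)
          have "s5 8 0 = of_bool (P \<and> C \<notin> set (take e New))"
            using 7(2)[of 8] s4 2(2) by simp
          moreover have "C = K \<longleftrightarrow> D n"
            using K(2) assms(6) by (auto simp: D_def)
          then have "P \<and> C \<notin> set (take (Suc e) New) \<longleftrightarrow> (P \<and> C \<notin> set (take e New)) \<and> \<not> D n"
            using 2(1) by (auto simp: take_Suc_conv_app_nth K_def)
          ultimately show ?case
            using 7(1) by (intro runs_Write) (simp add: of_bool_diff_nat)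
        qed (use assms s4 in auto)
      qed
    qed (use assms 2(1) in auto)
  next
    case (4 s')
    show ?case
      using 4[of 5] 4[of 6] assms(2,3) by (simp add: items_def)
  qed (use assms in auto)
  then show ?thesis by simp
qed

text \<open>The test result is 0 or 1, so adding it to the number of items accepts or drops the
  candidate without branching.\<close>

definition try_add :: prog where
  "try_add = Seq maximal_test (Seq new_test (assign 6 (Add (var 6) (var 8))))"

definition try_time :: "'b::comm_semiring_1 \<Rightarrow> 'b" where
  "try_time B = (1 + test_time B) + (test_time B + 1)"

lemma writes_try_add [simp]: "writes try_add = {6, 8, 11, 12, 13, 14, 15, 16, 17}"
  by (auto simp: try_add_def)

definition extend :: "(nat \<Rightarrow> nat \<Rightarrow> bool) \<Rightarrow> nat \<Rightarrow> nat set \<Rightarrow> nat set list \<Rightarrow> nat set list" where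
  "extend E i C New =
     (if (\<forall>x\<in>{..<Suc i} - C. \<exists>y\<in>C. \<not> E x y) \<and> C \<notin> set New then New @ [C] else New)"

lemma runs_try_add:
  assumes "matrix (s 0) n E" "s 3 0 = i" "i < n" "s 5 0 = length Old" "items s n (Old @ New)"
    and "s 9 0 = length (Old @ New) * n" "row (s 2) (length (Old @ New) * n) n C"
    and "C \<subseteq> {..<n}" "\<And>K. K \<in> set New \<Longrightarrow> K \<subseteq> {..<n}" "n \<le> B" "length (Old @ New) \<le> B"
  shows "runs try_add s (try_time B) (\<lambda>s'. items s' n (Old @ extend E i C New))"
  unfolding try_add_def try_time_def
proof (rule runs_Seq'[OF runs_maximal_test[OF assms(1-3,6-8,10)]], goal_cases)
  case (1 s1)
  let ?P = "\<forall>x\<in>{..<Suc i} - C. \<exists>y\<in>C. \<not> E x y"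
  have s1: "s1 0 = s 0" "s1 5 = s 5" "s1 6 = s 6" "s1 2 = s 2" "s1 9 = s 9"
    using 1(2)[of 0] 1(2)[of 5] 1(2)[of 6] 1(2)[of 2] 1(2)[of 9] by simp_all
  have "s1 0 0 = n" "s1 5 0 = length Old" "items s1 n (Old @ New)"
      "s1 9 0 = length (Old @ New) * n" "row (s1 2) (length (Old @ New) * n) n C"
    using assms s1 by (simp_all add: matrix_def items_def)
  then have "runs new_test s1 (test_time B) (\<lambda>s'. s' 8 0 = of_bool (?P \<and> C \<notin> set New))"
    using assms(8-11) 1(1) by (intro runs_new_test) auto
  then show ?case
  proof (rule runs_Seq', goal_cases)
    case (1 s2)
    have s2: "s2 6 = s 6" "s2 2 = s 2"
      using 1(2)[of 6] 1(2)[of 2] s1 by simp_all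
    show ?case
    proof (rule runs_Write)
      let ?s = "s2(6 := (s2 6)(val (Const 0) s2 := val (Add (var 6) (var 8)) s2))"
      have "?s 2 = s 2" "?s 6 0 = s 6 0 + of_bool (?P \<and> C \<notin> set New)"
        using 1(1) s2 by simp_all
      then show "items ?s n (Old @ extend E i C New)"
        using items_cong[OF assms(5)] items_snoc[OF assms(5,7)] by (auto simp: extend_def)
    qed
  qed
qed

section \<open>One round: adding a vertex\<close>

lemma items_row: "items s n Ls \<Longrightarrow> c < length Ls \<Longrightarrow> row (s 2) (c * n) n (Ls ! c)"
  by (simp add: items_def)

lemma items_above:
  assumes "items s n Ls" "s' 6 0 = s 6 0" "\<And>p. p < length Ls * n \<Longrightarrow> s' 2 p = s 2 p"
  shows "items s' n Ls"
proof -
  have "s' 2 (c * n + j) = s 2 (c * n + j)" if "c < length Ls" "j < n" for c j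
  proof (rule assms(3))
    have "c * n + j < Suc c * n" using that(2) by simp
    also have "\<dots> \<le> length Ls * n" using that(1) by (intro mult_le_mono1) simp
    finally show "c * n + j < length Ls * n" .
  qed
  then show ?thesis
    using assms(1,2) by (simp add: items_def row_def)
qed

text \<open>The end of the queue is computed again for the second candidate because the first one
  may have been accepted.\<close>

definition round_body :: prog where
  "round_body = Seq (mul 10 (Add (var 4) (var 7))) (Seq (mul 9 (var 6)) (Seq copy_row (Seq try_add
     (Seq (mul 9 (var 6)) (Seq restrict_row try_add)))))"

definition body_time :: "'b::comm_semiring_1 \<Rightarrow> 'b" where
  "body_time B = mul_time B + (mul_time B + (for_time B 1 + (try_time B +
     (mul_time B + (restrict_time B + try_time B)))))"

lemma writes_round_body [simp]: "writes round_body = {2, 6, 8, 9, 10, 11, 12, 13, 14, 15, 16, 17}"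
  by (auto simp: round_body_def)

lemma runs_round_body:
  assumes "matrix (s 0) n E" "s 3 0 = i" "i < n" "s 5 0 = length Old" "items s n (Old @ New)"
    and "s 4 0 + s 7 0 < length Old" "K = Old ! (s 4 0 + s 7 0)" "K \<subseteq> {..<n}"
    and "\<And>K. K \<in> set New \<Longrightarrow> K \<subseteq> {..<n}" "n \<le> B" "length (Old @ New) + 1 \<le> B"
  shows "runs round_body s (body_time B)
    (\<lambda>s'. items s' n (Old @ extend E i (insert i {x \<in> K. E i x}) (extend E i K New)))"
proof -
  define b where "b = (s 4 0 + s 7 0) * n"
  have K: "row (s 2) b n K" "s 0 0 = n"
    using items_row[OF assms(5), of "s 4 0 + s 7 0"] assms(1,6,7)
    by (simp_all add: nth_append b_def matrix_def)
  \<comment> \<open>The source row ends before any candidate starts, so writing candidates leaves it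
    intact.\<close>
  have below: "b + n \<le> c * n" if "length Old \<le> c" for c
  proof -
    have "b + n = Suc (s 4 0 + s 7 0) * n" by (simp add: b_def)
    also have "\<dots> \<le> c * n" using assms(6) that by (intro mult_le_mono1) simp
    finally show ?thesis .
  qed
  let ?New = "extend E i K New"
  have New: "K \<subseteq> {..<n}" if "K \<in> set ?New" for K
    using that assms(8,9) by (auto simp: extend_def split: if_splits)
  have len: "length ?New \<le> Suc (length New)"
    by (simp add: extend_def)
  show ?thesis
    unfolding round_body_def body_time_def
  proof (rule runs_Seq'[OF runs_mul[where k = "s 4 0 + s 7 0"]], goal_cases)
    case (4 s')
    show ?case using 4[of 4] 4[of 7] by simp
  next
    case (5 s1)
    have s1: "s1 10 0 = b" "s1 0 = s 0" "s1 2 = s 2" "s1 3 = s 3" "s1 5 = s 5" "s1 6 = s 6"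
      using 5(1) 5(2)[of 0] 5(2)[of 2] 5(2)[of 3] 5(2)[of 5] 5(2)[of 6] K(2) by (simp_all add: b_def)
    show ?case
    proof (rule runs_Seq'[OF runs_mul[where k = "length (Old @ New)"]], goal_cases)
      case (4 s')
      show ?case using 4[of 6] s1 assms(5) by (simp add: items_def)
    next
      case (5 s2)
      have s2: "s2 9 0 = length (Old @ New) * n" "s2 10 0 = b" "s2 0 = s 0" "s2 2 = s 2" "s2 3 = s 3"
          "s2 5 = s 5" "s2 6 = s 6"
        using 5(1) 5(2)[of 0] 5(2)[of 2] 5(2)[of 3] 5(2)[of 5] 5(2)[of 6] 5(2)[of 10] s1 K(2)
        by simp_all
      show ?case
      proof (rule runs_Seq'[OF runs_copy_row[where b = "length (Old @ New) * n" and b' = b and n = n and K = K]],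
          goal_cases)
        case (7 s3)
        have s3: "s3 9 = s2 9" "s3 10 = s2 10" "s3 0 = s 0" "s3 3 = s 3" "s3 5 = s 5" "s3 6 = s 6"
          using 7(2)[of 9] 7(2)[of 10] 7(2)[of 0] 7(2)[of 3] 7(2)[of 5] 7(2)[of 6] s2 by simp_all
        have items3: "items s3 n (Old @ New)"
          by (rule items_above[OF assms(5)]) (use 7(1) s2 s3 in auto)
        have b3: "row (s3 2) b n K"
        proof -
          have "b + j < length (Old @ New) * n" if "j < n" for j
            using below[of "length (Old @ New)"] that by simp
          then show ?thesis
            using K(1) 7(1) s2 by (simp add: row_def)
        qed
        show ?case
        proof (rule runs_Seq'[OF runs_try_add[where n = n and E = E and i = i and Old = Old and New = New
                and C = K]], goal_cases)
          case (12 s4)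
          have s4: "s4 10 0 = b" "s4 0 = s 0" "s4 2 = s3 2" "s4 3 = s 3" "s4 5 = s 5"
            using 12(2)[of 10] 12(2)[of 0] 12(2)[of 2] 12(2)[of 3] 12(2)[of 5] s2 s3 by simp_all
          show ?case
          proof (rule runs_Seq'[OF runs_mul[where k = "length (Old @ ?New)"]], goal_cases)
            case (4 s')
            show ?case using 4[of 6] 12(1) by (simp add: items_def)
          next
            case (5 s5)
            have s5: "s5 9 0 = length (Old @ ?New) * n" "s5 10 0 = b" "s5 0 = s 0" "s5 2 = s3 2" "s5 3 = s 3"
                "s5 5 = s 5" "s5 6 = s4 6"
              using 5(1) 5(2)[of 10] 5(2)[of 0] 5(2)[of 2] 5(2)[of 3] 5(2)[of 5] 5(2)[of 6] s4 K(2)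
              by simp_all
            show ?case
            proof (rule runs_Seq'[OF runs_restrict_row[where n = n and E = E and i = i and K = K
                    and b = "length (Old @ ?New) * n" and b' = b]], goal_cases)
              case (9 s6)
              have s6: "s6 9 = s5 9" "s6 0 = s 0" "s6 3 = s 3" "s6 5 = s 5" "s6 6 = s4 6"
                using 9(2)[of 9] 9(2)[of 0] 9(2)[of 3] 9(2)[of 5] 9(2)[of 6] s5 by simp_all
              have "items s6 n (Old @ ?New)"
                by (rule items_above[OF 12(1)]) (use 9(1) s4 s5 s6 in simp_all)
              moreover have "insert i {x \<in> K. E i x} \<subseteq> {..<n}"
                using assms(3,8) by auto
              ultimately show ?case
                using assms(1-4,10,11) s5 s6 9(1) New len by (intro runs_try_add) simp_all
            qed (use assms s5 b3 below[of "length (Old @ ?New)"] in auto)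
          qed (use assms len in auto)
        qed (use assms s2 s3 7(1) items3 in auto)
      qed (use assms s2 K below[of "length (Old @ New)"] in auto)
    qed (use assms in auto)
  qed (use assms in auto)
qed

definition clique_round :: prog where
  "clique_round = Seq (assign 5 (var 6)) (Seq (for_loop 7 (Sub (var 5) (var 4)) round_body) (assign 4 (var 5)))"

definition round_time :: "'b::comm_semiring_1 \<Rightarrow> 'b" where
  "round_time B = 1 + (for_time B (body_time B) + 1)"

lemma writes_clique_round [simp]: "writes clique_round = {2, 4, 5, 6, 7, 8, 9, 10, 11, 12, 13, 14, 15, 16, 17}"
  by (auto simp: clique_round_def)

lemma set_extend:
  "set (extend E i C New) = set New \<union> {D \<in> {C}. \<forall>x\<in>{..<Suc i} - D. \<exists>y\<in>D. \<not> E x y}"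
  by (auto simp: extend_def)

lemma distinct_extend: "distinct New \<Longrightarrow> distinct (extend E i C New)"
  by (simp add: extend_def)

lemma runs_clique_round:
  assumes "matrix (s 0) n E" "symp E" "s 3 0 = i" "i < n" "items s n (Old @ Cur)" "s 4 0 = length Old"
    and "set Cur = max_cliques_on E {..<i}"
    and "n \<le> B" "length (Old @ Cur) + card (max_cliques_on E {..<Suc i}) + 1 \<le> B"
  shows "runs clique_round s (round_time B) (\<lambda>s'. \<exists>New. items s' n ((Old @ Cur) @ New) \<and>
    s' 4 0 = length (Old @ Cur) \<and> distinct New \<and> set New = max_cliques_on E {..<Suc i})"
proof -
  \<comment> \<open>\<open>cand\<close> distributes over unions, so it describes the current round
    after any number of old cliques; for all of them it is the right-hand side of
    \<open>max_cliques_on_insert\<close>.\<close>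
  define cand where "cand A = {C \<in> A \<union> (\<lambda>K. insert i {x \<in> K. E i x}) ` A.
      \<forall>x\<in>{..<Suc i} - C. \<exists>y\<in>C. \<not> E x y}" for A
  have cand_Cur: "cand (set Cur) = max_cliques_on E {..<Suc i}"
    unfolding cand_def assms(7) lessThan_Suc
    using max_cliques_on_insert[of "{..<i}" E i] assms(2) by simp
  have sub: "K \<subseteq> {..<n}" if "K \<in> set Cur" for K
    using that assms(4,7) by (auto simp: max_cliques_on_def)
  have cand_mono: "cand A \<subseteq> cand A'" if "A \<subseteq> A'" for A A'
    using that by (auto simp: cand_def)
  let ?I = "\<lambda>c s'. \<exists>New. items s' n ((Old @ Cur) @ New) \<and> distinct New \<and> set New = cand (set (take c Cur))"
  show ?thesis
    unfolding clique_round_def round_time_def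
  proof (rule runs_Seq'[OF runs_assign], goal_cases)
    case (1 s1)
    have s1: "s1 0 = s 0" "s1 2 = s 2" "s1 3 = s 3" "s1 4 = s 4" "s1 6 = s 6" "s1 5 0 = length (Old @ Cur)"
      using 1(1) assms(5) by (simp_all add: items_def)
    show ?case
    proof (rule runs_Seq'[OF runs_for_loop[where N = "length Cur" and I = ?I]], goal_cases)
      case 1
      have "items (s1(7 := (s1 7)(0 := 0))) n ((Old @ Cur) @ [])"
        using assms(5) s1 by (simp add: items_def)
      then show ?case
        by (intro exI[of _ "[]"]) (simp add: cand_def)
    next
      case (2 c s2)
      then obtain New where New: "items s2 n ((Old @ Cur) @ New)" "distinct New"
          "set New = cand (set (take c Cur))"
        by blast
      have s2: "s2 0 = s 0" "s2 3 = s 3" "s2 4 = s 4" "s2 5 0 = length (Old @ Cur)"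
        using 2(4)[of 0] 2(4)[of 3] 2(4)[of 4] 2(4)[of 5] s1 by simp_all
      define K where "K = Cur ! c"
      have K: "K \<in> set Cur" "K = (Old @ Cur) ! (s2 4 0 + s2 7 0)"
        using 2(1,3) s2 assms(6) by (simp_all add: K_def)
      \<comment> \<open>Already the unfinished round contains only cliques of its final result,
        which bounds the queue, and with it the running time, throughout the round.\<close>
      have "set New \<subseteq> max_cliques_on E {..<Suc i}"
        using New(3) cand_mono[of "set (take c Cur)" "set Cur"] cand_Cur set_take_subset by fastforce
      moreover have "K \<subseteq> {..<n}" if "K \<in> max_cliques_on E {..<Suc i}" for K
        using that assms(4) by (auto simp: max_cliques_on_def)
      ultimately have New': "card (set New) \<le> card (max_cliques_on E {..<Suc i})" "\<And>K. K \<in> set New \<Longrightarrow> K \<subseteq> {..<n}"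
        by (auto intro!: card_mono finite_max_cliques_on)
      have "runs round_body s2 (body_time B) (\<lambda>s'. items s' n
          ((Old @ Cur) @ extend E i (insert i {x \<in> K. E i x}) (extend E i K New)))"
      proof (rule runs_round_body[OF _ _ assms(4) _ New(1) _ K(2) sub[OF K(1)] New'(2) assms(8)])
        show "length ((Old @ Cur) @ New) + 1 \<le> B"
          using assms(9) New'(1) distinct_card[OF New(2)] by simp
      qed (use assms s2 2(1,3) in simp_all)
      moreover have "set (extend E i (insert i {x \<in> K. E i x}) (extend E i K New)) =
          cand (set (take (Suc c) Cur))"
        using 2(1) unfolding set_extend New(3) by (auto simp: cand_def take_Suc_conv_app_nth K_def)
      moreover have "distinct (extend E i (insert i {x \<in> K. E i x}) (extend E i K New))"
        by (intro distinct_extend New(2))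
      ultimately show ?case
        by (rule_tac runs_conseq[OF _ order_refl]) blast+
    next
      case (4 s')
      then show ?case
        using 4[of 5] 4[of 4] s1 assms(6) by simp
    next
      case (5 c s' k)
      then show ?case by (simp add: items_def)
    next
      case (7 s3)
      have "s3 5 0 = length (Old @ Cur)"
        using 7(2)[of 5] s1 by simp
      then show ?case
        using 7(1) cand_Cur by (intro runs_Write) (simp add: items_def)
    qed (use assms in auto)
  qed
qed

definition search_cliques :: prog where
  "search_cliques = Seq (assign 6 (Const 1)) (for_loop 3 order_var clique_round)"

definition search_time :: "'b::comm_semiring_1 \<Rightarrow> 'b" where
  "search_time B = 1 + for_time B (round_time B)"

lemma writes_search_cliques [simp]: "writes search_cliques = {2, 3, 4, 5, 6, 7, 8, 9, 10, 11, 12, 13, 14, 15, 16, 17}"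
  by (auto simp: search_cliques_def)

text \<open>Earlier rounds stay in the queue, so its length is at most 1 for the initial clique plus
  \<open>M\<close> per round; the remaining 1 in \<open>2 + n * M\<close> is the slot of a candidate
  behind the end.\<close>

lemma runs_search_cliques:
  assumes "matrix (s 0) n E" "symp E" "\<And>m. m \<noteq> 0 \<Longrightarrow> s m = (\<lambda>_. 0)"
    and card: "\<And>i. i \<le> n \<Longrightarrow> card (max_cliques_on E {..<i}) \<le> M"
    and B: "n \<le> B" "2 + n * M \<le> B"
  shows "runs search_cliques s (search_time B) (\<lambda>s'. \<exists>Old Cur. items s' n (Old @ Cur) \<and>
    s' 4 0 = length Old \<and> distinct Cur \<and> set Cur = max_cliques_on E {..<n} \<and> length (Old @ Cur) \<le> B)"
proof -
  let ?I = "\<lambda>i s'. \<exists>Old Cur. items s' n (Old @ Cur) \<and> s' 4 0 = length Old \<and> distinct Cur \<and>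
    set Cur = max_cliques_on E {..<i} \<and> length (Old @ Cur) \<le> 1 + i * M"
  have "runs search_cliques s (search_time B) (?I n)"
    unfolding search_cliques_def search_time_def
  proof (rule runs_Seq'[OF runs_assign], goal_cases)
    case (1 s1)
    have s1: "s1 0 = s 0" "\<And>p. s1 2 p = 0" "s1 4 0 = 0" "s1 6 0 = 1"
      using 1(1) assms(3)[of 2] assms(3)[of 4] by simp_all
    show ?case
    proof (rule runs_for_loop[where N = n and I = ?I], goal_cases)
      case 1
      show ?case
        \<comment> \<open>The initial empty clique needs no writing: memory 2 is zero, and setting
          the number of items to 1 makes its first row an item.\<close>
        using s1 by (intro exI[of _ "[]"] exI[of _ "[{}]"]) (simp add: items_def row_def)
    next
      case (2 i s2)
      then obtain Old Cur where I: "items s2 n (Old @ Cur)" "s2 4 0 = length Old"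
          "set Cur = max_cliques_on E {..<i}" "length (Old @ Cur) \<le> 1 + i * M"
        by blast
      have M: "card (max_cliques_on E {..<Suc i}) \<le> M"
        using card 2(1) by simp
      have "1 + i * M + M + 1 \<le> 2 + n * M"
        using mult_le_mono1[of "Suc i" n M] 2(1) by simp
      then have fits: "length (Old @ Cur) + card (max_cliques_on E {..<Suc i}) + 1 \<le> B"
        using I(4) M B(2) by linarith
      have "matrix (s2 0) n E"
        using 2(4)[of 0] s1 assms(1) by simp
      then have "runs clique_round s2 (round_time B) (\<lambda>s'. \<exists>New. items s' n ((Old @ Cur) @ New) \<and>
          s' 4 0 = length (Old @ Cur) \<and> distinct New \<and> set New = max_cliques_on E {..<Suc i})"
        using 2(1,3) I(1-3) fits B(1) assms(2) by (intro runs_clique_round)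
      then show ?case
      proof (rule runs_conseq[OF _ order_refl], elim exE conjE)
        fix s' New assume New: "items s' n ((Old @ Cur) @ New)" "s' 4 0 = length (Old @ Cur)"
          "distinct New" "set New = max_cliques_on E {..<Suc i}"
        then have "length New \<le> M"
          using M distinct_card[OF New(3)] by simp
        then have "length ((Old @ Cur) @ New) \<le> 1 + Suc i * M"
          using I(4) by simp
        then show "?I (Suc i) s'"
          using New by blast
      qed
    next
      case (5 i s' k)
      then show ?case by (simp add: items_def)
    qed (use assms(1) s1 B in \<open>auto simp: matrix_def\<close>)
  qed
  then show ?thesis
  proof (rule runs_conseq[OF _ order_refl])
    fix s' assume "?I n s'"
    moreover have "1 + n * M \<le> B" using B(2) by simp
    ultimately show "\<exists>Old Cur. items s' n (Old @ Cur) \<and> s' 4 0 = length Old \<and> distinct Cur \<and>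
        set Cur = max_cliques_on E {..<n} \<and> length (Old @ Cur) \<le> B"
      using order_trans by blast
  qed
qed

section \<open>Output of the list of cliques\<close>

definition written :: "store \<Rightarrow> nat list \<Rightarrow> bool" where
  "written s ys \<longleftrightarrow> s 18 0 = length ys \<and> is_output s ys"

lemma is_output_snoc: "is_output s ys \<Longrightarrow> s' 1 = (s 1)(length ys := y) \<Longrightarrow> is_output s' (ys @ [y])"
  by (auto simp: is_output_def nth_append less_Suc_eq)

lemma is_output_upd: "is_output s ys \<Longrightarrow> s' 1 = (s 1)(length ys := y) \<Longrightarrow> is_output s' ys"
  by (auto simp: is_output_def)

lemma written_cong: "written s ys \<Longrightarrow> s' 1 = s 1 \<Longrightarrow> s' 18 = s 18 \<Longrightarrow> written s' ys"
  by (simp add: written_def is_output_def)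

definition elems :: "nat \<Rightarrow> nat set \<Rightarrow> nat list" where
  "elems n K = filter (\<lambda>j. j \<in> K) [0..<n]"

lemma elems_0 [simp]: "elems 0 K = []"
  by (simp add: elems_def)

lemma elems_Suc [simp]: "elems (Suc j) K = elems j K @ (if j \<in> K then [j] else [])"
  by (simp add: elems_def)

text \<open>
  Every index is written to the output, but the output position only advances past members of the
  clique, so that the others are overwritten or lie behind the end.
\<close>

definition emit :: prog where
  "emit = Seq (mul 10 (Add (var 4) (var 7))) (Seq (assign 19 (Const 0))
     (Seq (for_loop 11 order_var (assign 19 (Add (var 19) (Read 2 (Add (var 10) (var 11))))))
     (Seq (Write 1 (var 18) (var 19)) (Seq (assign 18 (Add (var 18) (Const 1)))
     (for_loop 11 order_var (Seq (Write 1 (var 18) (var 11))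
        (assign 18 (Add (var 18) (Read 2 (Add (var 10) (var 11))))))))))) "

definition emit_time :: "'b::comm_semiring_1 \<Rightarrow> 'b" where
  "emit_time B = mul_time B + (1 + (for_time B 1 + (1 + (1 + for_time B (1 + 1)))))"

lemma writes_emit [simp]: "writes emit = {1, 10, 11, 17, 18, 19}"
  by (auto simp: emit_def)

lemma runs_emit:
  assumes "s 0 0 = n" "items s n Ls" "s 4 0 + s 7 0 < length Ls" "K = Ls ! (s 4 0 + s 7 0)"
    and "written s ys" "n \<le> B" "length Ls \<le> B"
  shows "runs emit s (emit_time B) (\<lambda>s'. written s' (ys @ length (elems n K) # elems n K))"
proof -
  define b where "b = (s 4 0 + s 7 0) * n"
  have K: "row (s 2) b n K"
    using items_row[OF assms(2,3)] assms(4) by (simp add: b_def)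
  show ?thesis
    unfolding emit_def emit_time_def
  proof (rule runs_Seq'[OF runs_mul[where k = "s 4 0 + s 7 0"]], goal_cases)
    case (4 s')
    show ?case using 4[of 4] 4[of 7] by simp
  next
    case (5 s1)
    have s1: "s1 10 0 = b" "s1 0 = s 0" "s1 2 = s 2" "s1 1 = s 1" "s1 18 = s 18"
      using 5(1) 5(2)[of 0] 5(2)[of 2] 5(2)[of 1] 5(2)[of 18] assms(1) by (simp_all add: b_def)
    show ?case
    proof (rule runs_Seq'[OF runs_assign], goal_cases)
      case (1 s2)
      have s2: "s2 10 0 = b" "s2 0 = s 0" "s2 2 = s 2" "s2 1 = s 1" "s2 18 = s 18" "s2 19 0 = 0"
        using 1(1) s1 by simp_all
      show ?case
      proof (rule runs_Seq'[OF runs_for_loop[where N = n and B = B and T = 1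
            and I = "\<lambda>j s'. s' 19 0 = length (elems j K)"]], goal_cases)
        case (2 j s3)
        have "s3 10 0 = b" "s3 2 = s 2"
          using 2(4)[of 10] 2(4)[of 2] s2 by simp_all
        then show ?case
          using 2(2,3) rowD[OF K 2(1)] by (intro runs_Write) simp
      next
        case (7 s3)
        have s3: "s3 10 0 = b" "s3 0 = s 0" "s3 2 = s 2" "s3 1 = s 1" "s3 18 = s 18"
          using 7(2)[of 10] 7(2)[of 0] 7(2)[of 2] 7(2)[of 1] 7(2)[of 18] s2 by simp_all
        show ?case
        proof (rule runs_Seq'[OF runs_assign], goal_cases)
          case (1 s4)
          let ?ys = "ys @ [length (elems n K)]"
          have s4: "s4 10 0 = b" "s4 0 = s 0" "s4 2 = s 2" "s4 18 = s 18"
              "s4 1 = (s 1)(length ys := length (elems n K))"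
            using 1(1) s3 assms(5) 7(1) by (simp_all add: written_def)
          have out4: "is_output s4 ?ys"
            using assms(5) s4(5) by (intro is_output_snoc) (auto simp: written_def)
          show ?case
          proof (rule runs_Seq'[OF runs_assign], goal_cases)
            case (1 s5)
            have s5: "s5 10 0 = b" "s5 0 = s 0" "s5 2 = s 2"
              using 1(1) s4 by simp_all
            have out5: "written s5 ?ys"
              using 1(1) s4 out4 assms(5) by (simp add: written_def is_output_def)
            have "runs (for_loop 11 order_var (Seq (Write 1 (var 18) (var 11))
                (assign 18 (Add (var 18) (Read 2 (Add (var 10) (var 11))))))) s5 (for_time B (1 + 1))
                (\<lambda>s'. written s' (?ys @ elems n K))"
            proof (rule runs_for_loop[where I = "\<lambda>j s'. written s' (?ys @ elems j K)"], goal_cases)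
              case (2 j s6)
              have s6: "s6 10 0 = b" "s6 2 = s 2"
                using 2(4)[of 10] 2(4)[of 2] s5 by simp_all
              show ?case
              proof (rule runs_Seq'[OF runs_assign], goal_cases)
                case (1 s7)
                let ?zs = "?ys @ elems j K"
                have s7: "s7 10 0 = b" "s7 2 = s 2" "s7 18 0 = length ?zs" "s7 11 0 = j"
                    "s7 1 = (s6 1)(length ?zs := j)"
                  using 1(1) s6 2(2,3) by (simp_all add: written_def)
                \<comment> \<open>Both readings of the output hold after writing \<open>j\<close>;
                  the following update of the position decides which one counts.\<close>
                have out: "is_output s7 ?zs" "is_output s7 (?zs @ [j])"
                  using is_output_upd[of s6 ?zs s7 j] is_output_snoc[of s6 ?zs s7 j] s7(5) 2(2)
                  by (simp_all add: written_def)
                show ?case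
                proof (rule runs_Write)
                  let ?s = "s7(18 := (s7 18)(val (Const 0) s7 :=
                    val (Add (var 18) (Read 2 (Add (var 10) (var 11)))) s7))"
                  have "?s 18 0 = length ?zs + of_bool (j \<in> K)" "?s 1 = s7 1"
                    using s7 rowD[OF K 2(1)] by simp_all
                  then show "written ?s (?ys @ elems (Suc j) K)"
                    using out by (cases "j \<in> K") (simp_all add: written_def is_output_def)
                qed
              qed
            next
              case (5 j s' k)
              then show ?case by (rule written_cong) simp_all
            qed (use assms s5 out5 in \<open>auto intro: written_cong\<close>)
            then show ?case by simp
          qed
        qed
      qed (use assms s2 in auto)
    qed
  qed (use assms in auto)
qed

text \<open>
  The graph without vertices has no maximal clique in the sense of \<^const>\<open>maximal_cliques\<close>, whereas
  \<^const>\<open>max_cliques_on\<close> admits the empty one; the second subtraction corrects the count.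
\<close>

definition count_exp :: exp where
  "count_exp = Sub (Sub (var 6) (var 4)) (Sub (Const 1) order_var)"

definition output_cliques :: prog where
  "output_cliques = Seq (Write 1 (Const 0) count_exp) (Seq (assign 18 (Const 1)) (for_loop 7 count_exp emit))"

definition output_time :: "'b::comm_semiring_1 \<Rightarrow> 'b" where
  "output_time B = 1 + (1 + for_time B (emit_time B))"

text \<open>For \<open>n = 0\<close> the correction subtracts 1, which brings the count to 0 because
  at most one clique is present.\<close>

lemma runs_output_cliques:
  assumes "s 0 0 = n" "items s n (Old @ Cur)" "s 4 0 = length Old"
    and "n \<le> B" "length (Old @ Cur) \<le> B" "n = 0 \<Longrightarrow> length Cur \<le> 1"
  shows "runs output_cliques s (output_time B)
    (\<lambda>s'. is_output s' (encode_lists (if n = 0 then [] else map (elems n) Cur)))"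
proof -
  define N where "N = (if n = 0 then 0 else length Cur)"
  let ?ys = "\<lambda>c. N # concat (map (\<lambda>K. length (elems n K) # elems n K) (take c Cur))"
  have count: "val count_exp s' = N" if "s' 0 = s 0" "s' 4 = s 4" "s' 6 = s 6" for s'
    using that assms by (auto simp: count_exp_def N_def items_def)
  have "runs output_cliques s (output_time B) (\<lambda>s'. written s' (?ys N))"
    unfolding output_cliques_def output_time_def
  proof (rule runs_Seq'[OF runs_assign], goal_cases)
    case (1 s1)
    have s1: "s1 1 = (s 1)(0 := N)" "s1 0 = s 0" "s1 2 = s 2" "s1 4 = s 4" "s1 6 = s 6"
      using 1(1) count[of s] by simp_all
    show ?case
    proof (rule runs_Seq'[OF runs_assign], goal_cases)
      case (1 s2)
      have s2: "s2 1 = (s 1)(0 := N)" "s2 0 = s 0" "s2 2 = s 2" "s2 4 = s 4" "s2 6 = s 6" "s2 18 0 = 1"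
        using 1(1) s1 by simp_all
      show ?case
      proof (rule runs_for_loop[where I = "\<lambda>c s'. written s' (?ys c)"], goal_cases)
        case 1
        show ?case using s2 by (simp add: written_def is_output_def)
      next
        case (2 c s3)
        have s3: "s3 0 = s 0" "s3 2 = s 2" "s3 4 = s 4" "s3 6 = s 6"
          using 2(4)[of 0] 2(4)[of 2] 2(4)[of 4] 2(4)[of 6] s2 by simp_all
        have c: "c < length Cur"
          using 2(1) by (simp add: N_def split: if_splits)
        have "runs emit s3 (emit_time B)
            (\<lambda>s'. written s' (?ys c @ length (elems n (Cur ! c)) # elems n (Cur ! c)))"
        proof (rule runs_emit[where Ls = "Old @ Cur"])
          show "items s3 n (Old @ Cur)"
            by (rule items_cong[OF assms(2)]) (use s3 in simp_all)
        qed (use assms s3 2 c in simp_all)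
        then show ?case
          using c by (simp add: take_Suc_conv_app_nth)
      next
        case (4 s')
        show ?case
          using 4[of 0] 4[of 4] 4[of 6] s2 by (intro count) simp_all
      next
        case (5 c s' k)
        then show ?case by (rule written_cong) simp_all
      qed (use assms in \<open>auto simp: N_def\<close>)
    qed
  qed
  moreover have "encode_lists (if n = 0 then [] else map (elems n) Cur) = ?ys N"
    by (simp add: N_def encode_lists_def comp_def)
  ultimately have "runs output_cliques s (output_time B)
      (\<lambda>s'. written s' (encode_lists (if n = 0 then [] else map (elems n) Cur)))"
    by simp
  then show ?thesis
    by (rule runs_conseq[OF _ order_refl]) (simp add: written_def)
qed

definition enumerate_max_cliques :: prog where
  "enumerate_max_cliques = Seq search_cliques output_cliques"

definition total_time :: "'b::comm_semiring_1 \<Rightarrow> 'b" where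
  "total_time B = search_time B + output_time B"

lemma runs_enumerate_max_cliques:
  assumes "matrix (s 0) n E" "symp E" "\<And>m. m \<noteq> 0 \<Longrightarrow> s m = (\<lambda>_. 0)"
    and "\<And>i. i \<le> n \<Longrightarrow> card (max_cliques_on E {..<i}) \<le> M"
    and "n \<le> B" "2 + n * M \<le> B"
  shows "runs enumerate_max_cliques s (total_time B) (\<lambda>s'. \<exists>Cur. distinct Cur \<and>
    set Cur = max_cliques_on E {..<n} \<and>
    is_output s' (encode_lists (if n = 0 then [] else map (elems n) Cur)))"
  unfolding enumerate_max_cliques_def total_time_def
proof (rule runs_Seq'[OF runs_search_cliques[where n = n and E = E and M = M]], goal_cases)
  case (7 s1)
  then obtain Old Cur where C: "items s1 n (Old @ Cur)" "s1 4 0 = length Old" "distinct Cur"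
      "set Cur = max_cliques_on E {..<n}" "length (Old @ Cur) \<le> B"
    by blast
  have "s1 0 0 = n"
    using 7(2)[of 0] assms(1) by (simp add: matrix_def)
  moreover have "length Cur \<le> 1" if "n = 0"
    using distinct_card[OF C(3)] C(4) that by simp
  ultimately have "runs output_cliques s1 (output_time B)
      (\<lambda>s'. is_output s' (encode_lists (if n = 0 then [] else map (elems n) Cur)))"
    using C assms(5) by (intro runs_output_cliques)
  then show ?case
    by (rule runs_conseq[OF _ order_refl]) (use C in blast)
qed (use assms in auto)

text \<open>Evaluation of polynomials is a semiring homomorphism, so it commutes with the time
  terms: a polynomial bound on the size parameter gives one on the running time.\<close>

lemma poly_total_time: "poly (total_time p) x = total_time (poly p x)"
  for p :: "'b::comm_semiring_1 poly"
  by (simp add: total_time_def search_time_def output_time_def round_time_def body_time_def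
      try_time_def restrict_time_def test_time_def emit_time_def mul_time_def for_time_def)

section \<open>Maximal cliques of powers\<close>

text \<open>A clique that can be enlarged at all can be enlarged by a single vertex; symmetry of
  adjacency makes the one-sided test sufficient.\<close>

lemma maximal_cliques_eq:
  assumes "symp (adjacent H)"
  shows "maximal_cliques H = max_cliques_on (adjacent H) (pverts H) - {{}}"
proof (intro equalityI subsetI)
  fix K assume K: "K \<in> maximal_cliques H"
  have "\<exists>x\<in>K. \<not> adjacent H v x" if "v \<in> pverts H - K" for v
  proof (rule ccontr)
    assume "\<not> ?thesis"
    then have "adjacent H v x" "adjacent H x v" if "x \<in> K" for x
      using that sympD[OF assms, of v x] by auto
    then have "Defs.clique H (insert v K)"
      using K that by (auto simp: maximal_cliques_def Defs.clique_def)
    then show False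
      using K that by (auto simp: maximal_cliques_def)
  qed
  then show "K \<in> max_cliques_on (adjacent H) (pverts H) - {{}}"
    using K by (auto simp: maximal_cliques_def Defs.clique_def max_cliques_on_def)
next
  fix K assume K: "K \<in> max_cliques_on (adjacent H) (pverts H) - {{}}"
  have "K' = K" if K': "Defs.clique H K'" "K \<subseteq> K'" for K'
  proof (rule ccontr)
    assume "K' \<noteq> K"
    then obtain v where v: "v \<in> K'" "v \<notin> K" using K'(2) by blast
    then have "v \<in> pverts H - K"
      using K'(1) by (auto simp: Defs.clique_def)
    then obtain x where "x \<in> K" "\<not> adjacent H v x"
      using K unfolding max_cliques_on_def by blast
    moreover from this have "x \<in> K'" "v \<noteq> x"
      using K'(2) v(2) by auto
    ultimately show False
      using K'(1) v(1) by (simp add: Defs.clique_def)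
  qed
  then show "K \<in> maximal_cliques H"
    using K by (auto simp: maximal_cliques_def Defs.clique_def max_cliques_on_def)
qed

text \<open>The exponent 3 comes from \<open>1 + n * n \<le> n ^ 3\<close>, valid from
  \<open>n = 2\<close> on. For \<open>n = 0\<close> and \<open>n = 1\<close> there are at most
  \<open>n\<close> non-empty maximal cliques.\<close>

lemma card_max_cliques_on_le_power:
  assumes "finite V" "symp E" "\<not> comatching_on E (Suc k) V"
  shows "card (max_cliques_on E V - {{}}) \<le> card V ^ (3 * k)"
proof -
  consider "card V = 0" | "card V = 1" | "2 \<le> card V"
    by linarith
  then show ?thesis
  proof cases
    case 1
    then show ?thesis using assms(1) by simp
  next
    case 2
    then obtain v where "V = {v}" by (auto simp: card_1_singleton_iff)
    then have "max_cliques_on E V - {{}} \<subseteq> {V}"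
      by (auto simp: max_cliques_on_def)
    then have "card (max_cliques_on E V - {{}}) \<le> 1"
      using card_mono[of "{V}" "max_cliques_on E V - {{}}"] by simp
    then show ?thesis using 2 by simp
  next
    case 3
    let ?n = "card V"
    have "card (max_cliques_on E V - {{}}) \<le> card (max_cliques_on E V)"
      using finite_max_cliques_on[OF assms(1)] by (intro card_mono) auto
    also have "\<dots> \<le> (1 + ?n * ?n) ^ k"
      by (rule card_max_cliques_on_le[OF assms])
    also have "\<dots> \<le> (?n ^ 3) ^ k"
    proof (rule power_mono)
      have "1 * 1 \<le> ?n * ?n"
        using 3 by (intro mult_le_mono) auto
      then have "1 + ?n * ?n \<le> 2 * (?n * ?n)" by simp
      also have "\<dots> \<le> ?n * (?n * ?n)" using 3 by (intro mult_right_mono) auto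
      finally show "1 + ?n * ?n \<le> ?n ^ 3" by (simp add: power3_eq_cube)
    qed simp
    finally show ?thesis by (simp add: power_mult)
  qed
qed

text \<open>Transports cliques between the positions handled by the machine and the vertices of the
  graph.\<close>

lemma max_cliques_on_image:
  assumes "inj_on f U" "\<And>u w. u \<in> U \<Longrightarrow> w \<in> U \<Longrightarrow> E' (f u) (f w) \<longleftrightarrow> E u w"
  shows "max_cliques_on E' (f ` U) = image f ` max_cliques_on E U"
proof -
  have iff: "f ` K \<in> max_cliques_on E' (f ` U) \<longleftrightarrow> K \<in> max_cliques_on E U" if "K \<subseteq> U" for K
  proof -
    have "f ` U - f ` K = f ` (U - K)"
      using inj_on_image_set_diff[OF assms(1), of U K] that by auto
    moreover have "f x \<noteq> f y \<longleftrightarrow> x \<noteq> y" if "x \<in> K" "y \<in> K" for x y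
      using that \<open>K \<subseteq> U\<close> inj_on_eq_iff[OF assms(1)] by blast
    moreover have "E' (f x) (f y) \<longleftrightarrow> E x y" if "x \<in> U" "y \<in> K" for x y
      using that \<open>K \<subseteq> U\<close> assms(2) by blast
    ultimately show ?thesis
      using that by (auto simp: max_cliques_on_def subset_iff)
  qed
  show ?thesis
  proof (intro equalityI subsetI)
    fix K' assume K': "K' \<in> max_cliques_on E' (f ` U)"
    then obtain K where "K \<subseteq> U" "K' = f ` K"
      using K' by (auto simp: max_cliques_on_def subset_image_iff)
    then show "K' \<in> image f ` max_cliques_on E U"
      using iff K' by blast
  next
    fix K' assume "K' \<in> image f ` max_cliques_on E U"
    then obtain K where "K \<in> max_cliques_on E U" "K' = f ` K" by blast
    then show "K' \<in> max_cliques_on E' (f ` U)"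
      using iff[of K] by (simp add: max_cliques_on_def)
  qed
qed

lemma inj_on_image_max_cliques_on:
  "inj_on f U \<Longrightarrow> inj_on (image f) (max_cliques_on E U)"
  by (rule inj_on_subset[OF inj_on_image_Pow]) (auto simp: max_cliques_on_def)

lemma length_concat_rows: "length (concat (map (\<lambda>u. map (g u) vs) us)) = length us * length vs"
  by (induction us) auto

lemma nth_concat_rows:
  "i < length us \<Longrightarrow> j < length vs \<Longrightarrow>
    concat (map (\<lambda>u. map (g u) vs) us) ! (i * length vs + j) = g (us ! i) (vs ! j)"
proof (induction us arbitrary: i)
  case (Cons u us)
  then show ?case by (cases i) (auto simp: nth_append)
qed simp

lemma length_encode_graph: "length (encode_graph (H, vs)) = 1 + length vs * length vs"
  by (simp add: encode_graph_def length_concat_rows[of "\<lambda>u v. if (u, v) \<in> parcs H then 1 else 0"])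

lemma matrix_encode_graph:
  "matrix (input_store (encode_graph (H, vs)) 0) (length vs)
     (\<lambda>i j. i < length vs \<and> j < length vs \<and> adjacent H (vs ! i) (vs ! j))"
proof -
  let ?n = "length vs"
  let ?g = "\<lambda>u v. if (u, v) \<in> parcs H then 1 else 0 :: nat"
  have "input_store (encode_graph (H, vs)) 0 (Suc (i * ?n + j)) = ?g (vs ! i) (vs ! j)"
    if "i < ?n" "j < ?n" for i j
  proof -
    have "i * ?n + j < Suc i * ?n" using that by simp
    also have "\<dots> \<le> ?n * ?n" using that(1) by (intro mult_le_mono1) simp
    finally have "Suc (i * ?n + j) < length (encode_graph (H, vs))"
      by (simp add: length_encode_graph)
    moreover have "encode_graph (H, vs) ! Suc (i * ?n + j) = ?g (vs ! i) (vs ! j)"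
      using nth_concat_rows[OF that, of ?g] by (simp add: encode_graph_def)
    ultimately show ?thesis by (simp add: input_store_def)
  qed
  moreover have "input_store (encode_graph (H, vs)) 0 0 = ?n"
    using length_encode_graph[of H vs] by (simp add: input_store_def encode_graph_def)
  ultimately show ?thesis
    by (simp add: matrix_def)
qed

lemma poly_time_maximal_cliques:
  fixes \<D> :: "'a pair_pre_digraph set"
  assumes "\<And>H. H \<in> \<D> \<Longrightarrow> pair_graph H"
    and "\<And>H. H \<in> \<D> \<Longrightarrow> \<not> comatching_on (adjacent H) (Suc k) (pverts H)"
  shows "poly_time_solvable (presentations \<D>) encode_graph enumerates_maximal_cliques"
proof -
  \<comment> \<open>At the input length \<open>?L\<close> this is
    \<open>2 + ?L + ?L ^ (k + 1)\<close>: it dominates both the number of vertices and the queue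
    bound \<open>2 + n * M\<close> with \<open>M = ?L ^ k\<close>.\<close>
  define P :: "nat poly" where "P = [:2, 1:] + [:0, 1:] ^ Suc k"
  have "\<exists>t s ys. exec enumerate_max_cliques (input_store (encode_graph x)) t s \<and>
      t \<le> poly (total_time P) (length (encode_graph x)) \<and> is_output s ys \<and> enumerates_maximal_cliques x ys"
    if "x \<in> presentations \<D>" for x
  proof -
    obtain H vs where x: "x = (H, vs)" by (cases x)
    then have H: "H \<in> \<D>" "distinct vs" "set vs = pverts H"
      using that by (auto simp: presentations_def)
    interpret pair_graph H by (rule assms(1)[OF H(1)])
    let ?n = "length vs"
    let ?L = "length (encode_graph x)"
    let ?f = "(!) vs"
    define E where "E i j \<longleftrightarrow> i < ?n \<and> j < ?n \<and> adjacent H (vs ! i) (vs ! j)" for i j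
    have L: "?L = 1 + ?n * ?n"
      by (simp add: x length_encode_graph)
    have symp_E: "symp E"
      using arcs_symmetric by (auto simp: E_def intro: sympI)
    have inj: "inj_on ?f {..<i}" if "i \<le> ?n" for i
      using that H(2) by (auto simp: inj_on_def nth_eq_iff_index_eq)
    have image: "max_cliques_on (adjacent H) (?f ` {..<i}) = image ?f ` max_cliques_on E {..<i}"
      if "i \<le> ?n" for i
      using that by (intro max_cliques_on_image inj) (auto simp: E_def)
    \<comment> \<open>The absence of co-matchings passes to every prefix, and the base
      \<open>1 + n * n\<close> of the counting bound is exactly the input length.\<close>
    have card: "card (max_cliques_on E {..<i}) \<le> ?L ^ k" if "i \<le> ?n" for i
    proof -
      let ?V = "?f ` {..<i}"
      have V: "?V \<subseteq> pverts H" "card ?V = i"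
        using that H(3) card_image[OF inj[OF that]] by auto
      have "card (max_cliques_on E {..<i}) = card (max_cliques_on (adjacent H) ?V)"
        unfolding image[OF that] by (rule card_image[OF inj_on_image_max_cliques_on[OF inj[OF that]], symmetric])
      also have "\<dots> \<le> (1 + card ?V * card ?V) ^ k"
      proof (rule card_max_cliques_on_le)
        show "\<not> comatching_on (adjacent H) (Suc k) ?V"
          using comatching_on_mono[OF _ V(1)] assms(2)[OF H(1)] by blast
      qed (simp_all add: symp_adjacent)
      also have "\<dots> \<le> ?L ^ k"
        unfolding V(2) L using that by (intro power_mono add_left_mono mult_le_mono) auto
      finally show ?thesis .
    qed
    have "?n \<le> ?L"
      unfolding L by (rule le_trans[OF le_square]) simp
    then have "?n * ?L ^ k \<le> ?L * ?L ^ k"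
      by (rule mult_le_mono1)
    moreover have "poly P ?L = 2 + ?L + ?L * ?L ^ k"
      by (simp add: P_def)
    ultimately have P: "?n \<le> poly P ?L" "2 + ?n * ?L ^ k \<le> poly P ?L"
      using \<open>?n \<le> ?L\<close> by linarith+
    have "matrix (input_store (encode_graph x) 0) ?n E"
      unfolding x E_def by (rule matrix_encode_graph)
    then have "runs enumerate_max_cliques (input_store (encode_graph x)) (total_time (poly P ?L))
      (\<lambda>s'. \<exists>Cur. distinct Cur \<and> set Cur = max_cliques_on E {..<?n} \<and>
        is_output s' (encode_lists (if ?n = 0 then [] else map (elems ?n) Cur)))"
      by (rule runs_enumerate_max_cliques[OF _ symp_E _ card P]) (simp_all add: input_store_def)
    then obtain t s Cur where run: "exec enumerate_max_cliques (input_store (encode_graph x)) t s"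
        "t \<le> poly (total_time P) ?L"
      and Cur: "distinct Cur" "set Cur = max_cliques_on E {..<?n}"
      and out: "is_output s (encode_lists (if ?n = 0 then [] else map (elems ?n) Cur))"
      unfolding runs_def poly_total_time by blast
    let ?Ks = "if ?n = 0 then [] else map (elems ?n) Cur"
    have elems: "distinct (elems ?n K)" "set (elems ?n K) = K" if "K \<in> set Cur" for K
      using that Cur(2) by (auto simp: elems_def max_cliques_on_def)
    have verts: "pverts H = ?f ` {..<?n}"
      using H(3) nth_image[of ?n vs] by (simp add: atLeast0LessThan)
    have "enumerates_maximal_cliques x (encode_lists ?Ks)"
    proof (cases "?n = 0")
      case True
      then have "maximal_cliques H = {}"
        using verts by (simp add: maximal_cliques_eq[OF symp_adjacent])
      then show ?thesis
        using True by (auto simp: x enumerates_maximal_cliques_def)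
    next
      case False
      have map: "map (\<lambda>K. ?f ` set K) ?Ks = map (image ?f) Cur"
        using False elems(2) by simp
      have "vs ! 0 \<in> pverts H"
        using False H(3) nth_mem[of 0 vs] by simp
      then have ne: "{} \<notin> max_cliques_on (adjacent H) (pverts H)"
        unfolding max_cliques_on_def by blast
      have "set (map (image ?f) Cur) = max_cliques_on (adjacent H) (pverts H)"
        by (simp only: set_map Cur(2) image[OF order_refl] verts)
      then have "set (map (image ?f) Cur) = maximal_cliques H"
        using ne by (simp add: maximal_cliques_eq[OF symp_adjacent])
      moreover have "distinct (map (image ?f) Cur)"
        using Cur inj_on_image_max_cliques_on[OF inj[OF order_refl]] by (simp add: distinct_map)
      moreover have "\<forall>K\<in>set ?Ks. distinct K \<and> (\<forall>i\<in>set K. i < ?n)"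
        by (auto simp: elems_def)
      ultimately show ?thesis
        unfolding x enumerates_maximal_cliques_def prod.case map[symmetric]
        by (intro exI[of _ ?Ks] conjI refl)
    qed
    then show ?thesis
      using run out by blast
  qed
  then show ?thesis
    unfolding poly_time_solvable_def by blast
qed

theorem theorem6p4:
  fixes \<C> :: "'a pair_pre_digraph set" and d :: nat
  assumes "\<forall>G\<in>\<C>. pair_graph G"
    and "nowhere_dense \<C>"
  shows "(\<exists>q::nat. \<forall>H\<in>induced_closure (graph_power d ` \<C>).
            card (maximal_cliques H) \<le> card (pverts H) ^ q) \<and>
         poly_time_solvable (presentations (induced_closure (graph_power d ` \<C>)))
           encode_graph enumerates_maximal_cliques"
proof -
  let ?D = "induced_closure (graph_power d ` \<C>)"
  obtain k where k: "\<forall>H\<in>?D. \<not> comatching_on (adjacent H) k (pverts H)"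
    using power_comatchings_bounded[OF assms] by blast
  \<comment> \<open>Both consequences below are stated for \<open>Suc k\<close>, so the bound is
    shifted by one; \<open>k\<close> itself may be 0 if the class is empty.\<close>
  have graph: "pair_graph H" if "H \<in> ?D" for H
    by (rule pair_graph_induced_power[OF assms(1) that])
  have no_comatching: "\<not> comatching_on (adjacent H) (Suc k) (pverts H)" if "H \<in> ?D" for H
    using k that comatching_on_SucD by blast
  have "card (maximal_cliques H) \<le> card (pverts H) ^ (3 * k)" if "H \<in> ?D" for H
  proof -
    interpret pair_graph H by (rule graph[OF that])
    show ?thesis
      unfolding maximal_cliques_eq[OF symp_adjacent]
      by (rule card_max_cliques_on_le_power[OF pair_finite_verts symp_adjacent no_comatching[OF that]])
  qed
  then show ?thesis
    using poly_time_maximal_cliques[OF graph no_comatching] by blast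
qed

end
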